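(* Let $T>0$ be an arbitrary finite number, $t^*\in(0,\min\{1,T\})$, and consider the equation $$\mathbf{D}_tu-\mathcal{L}_1u-\mathcal{K}*\mathcal{L}_2u+g(u)=g_0(x,t)\quad\text{in }\Omega_T \tag{E}$$ with the initial condition $u(x,0)=u_0(x)$ in $\bar\Omega$ (I), together with one of the observations for $t\in[0,t^*]$: $$\text{(LO)}\quad u(x_0,t)=\psi(t)\ \text{ for a given }x_0\in\bar\Omega;\qquad\text{(NLO)}\quad \int_\Omega u(x,t)\,dx=\psi(t).$$ Assume hypotheses (A1)–(A6) of the context and $\mathfrak{C}_0\neq0$, where $$\mathfrak{C}_0=\begin{cases} g_0(x_0,0)-g(u_0)|_{x_0}+\mathcal{L}_1u_0|_{(x_0,0)} & \text{for LO},\\ \int_\Omega\mathcal{L}_1u_0|_{t=0}\,dx-\int_\Omega g(u_0)\,dx+\int_\Omega g_0(x,0)\,dx & \text{for NLO}.\end{cases}$$ Assume that a unique solution $u$ of (E) in $\Omega_T$ is a local classical solution of (E), (I) in $\Omega_{t^*}$ and that $u$ satisfies the observation (LO), respectively (NLO), on $[0,t^*]$. Then the unknown order $\nu_0$ is computed via $$\nu_0=\begin{cases}\displaystyle\lim_{t\to0}\frac{t[\psi(t)-\psi(0)]}{\int_0^t[\psi(\tau)-\psi(0)]\,d\tau}-1 & \text{for the type I operator},\\[2mm] \displaystyle\lim_{t\to0}\frac{t[r(t)\psi(t)-r(0)\psi(0)]}{\int_0^t[r(\tau)\psi(\tau)-r(0)\psi(0)]\,d\tau}-1 & \text{for the type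 II operator},\end{cases}$$ where $r(t)=r_0(x_0,t)$ for LO, $r(t)=r_0(t)$ for NLO, and $\psi(0)=u_0(x_0)$ for LO, $\psi(0)=\int_\Omega u_0(x)dx$ for NLO. Moreover, the reconstruction of $\nu_0$ via the observation $\psi(t)$, $t\in[0,t^*]$, satisfying (A5) is unique: two orders corresponding to the same observation $\psi$ coincide.
   Context: $\Omega\subset\mathbb{R}^n$ is a bounded domain with boundary $\partial\Omega\in\mathcal{C}^{2+\alpha}$, $\alpha\in(0,1)$ fixed; $\Omega_T=\Omega\times(0,T)$, $\partial\Omega_T=\partial\Omega\times[0,T]$. The time convolution is $(\eta_1*\eta_2)(t)=\int_0^t\eta_1(t-\tau)\eta_2(\tau)d\tau$. For $\nu\in(0,1)$ the regularized Caputo derivative in time is $\mathbf{D}_t^{\nu}v=\frac{1}{\Gamma(1-\nu)}\frac{\partial}{\partial t}\int_0^t\frac{v(\cdot,s)-v(\cdot,0)}{(t-s)^{\nu}}ds$ (value at $t=0$ by continuous extension). The operator $\mathbf{D}_t$, with $0<\nu_M<\dots<\nu_1<\nu_0<1$, is $$\mathbf{D}_tu=\sum_{i=0}^Mr_i\mathbf{D}_t^{\nu_i}u\ \text{(type I)}\quad\text{or}\quad \mathbf{D}_tu=\sum_{i=0}^M\mathbf{D}_t^{\nu_i}(r_iu)\ \text{(type II)}.$$ (A1) $\mathcal{L}_1=\sum_{i,j=1}^na_{ij}(x,t)\partial_{x_i}\partial_{x_j}+\sum_{i=1}^na_i(x,t)\partial_{x_i}+a_0(x,t)$, $\mathcal{L}_2=\sum_{i,j=1}^nb_{ij}(x,t)\partial_{x_i}\partial_{x_j}+\sum_{i=1}^nb_i(x,t)\partial_{x_i}+b_0(x,t)$,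 and (boundary operators, which do not enter (E), (I)) $\mathcal{N}_1=\sum_{i=1}^nc_i(x,t)\partial_{x_i}+c_0(x,t)$, $\mathcal{N}_2=\sum_{i=1}^nd_i(x,t)\partial_{x_i}+d_0(x,t)$. There are constants $\delta_2>\delta_1>0$, $\delta_3>0$ with $\delta_1|\xi|^2\le\sum_{i,j}a_{ij}(x,t)\xi_i\xi_j\le\delta_2|\xi|^2$ for all $(x,t,\xi)\in\bar\Omega_T\times\mathbb{R}^n$ and $\sum_ic_i(x,t)N_i(x)\ge\delta_3$ on $\partial\Omega_T$, $N=(N_1,\dots,N_n)$ being the unit outward normal. (A2) $r_i=r_i(x,t)$ for LO and $r_i=r_i(t)$ for NLO, $i=0,\dots,M$; $0<\nu_M<\dots<\nu_1<\nu_0<1$ and $\nu_1<\frac{\nu_0(2-\alpha)}{2}$ (if the equation is considered with a fractional dynamic boundary condition, $\nu_1<\frac{\nu_0(1-\alpha)}{2}$); there is $\delta_4>0$ with $r_0\ge\delta_4$ for all $x\in\bar\Omega$, $t\in[0,T]$. (A3) For all $i=0,\dots,M$: for LO, $r_i\in\mathcal{C}(\bar\Omega_T)$ (type I) or $r_i\in\mathcal{C}(\bar\Omega,\mathcal{C}^1[0,T])$ (type II); for NLO, $r_i\in\mathcal{C}([0,T])$ (type I) or $r_i\in\mathcal{C}^1([0,T])$ (type II). (A4) $\mathcal{K},\mathcal{K}_1\in L^1(0,T)$ ($\mathcal{K}_1$ is a memory kernel in boundary conditions and does not enter (E), (I)). (A5) $\psi\in\mathcal{C}([0,t^*])$ has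 regularized Caputo derivatives of orders $\nu_i$, $i=0,1,\dots,M$, and all these derivatives are Hölder continuous on $[0,t^*]$. (A6) $a_{ij},b_{ij},a_i,b_i,a_0,b_0\in\mathcal{C}(\bar\Omega_T)$ for $i,j=1,\dots,n$; $u_0\in\mathcal{C}^2(\bar\Omega)$, $g_0\in\mathcal{C}(\bar\Omega_T)$, $g\in\mathcal{C}(\mathbb{R})$. *)

theory Defs
  imports "HOL-Analysis.Analysis"
begin

definition tconv :: "(real \<Rightarrow> real) \<Rightarrow> (real \<Rightarrow> real) \<Rightarrow> real \<Rightarrow> real" where
  "tconv \<eta>1 \<eta>2 t = integral {0..t} (\<lambda>s. \<eta>1 (t - s) * \<eta>2 s)"

definition caputo_prim :: "real \<Rightarrow> (real \<Rightarrow> real) \<Rightarrow> real \<Rightarrow> real" where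
  "caputo_prim \<mu> v t = integral {0..t} (\<lambda>s. (v s - v 0) / (t - s) powr \<mu>)"

text \<open>The formula below is meaningful at interior times only. The values at the two ends of a
  time interval are by definition those of the continuous extension, i.e. the values of the
  function \<open>w\<close> in \<open>caputo_on\<close>.\<close>

definition caputo :: "real \<Rightarrow> (real \<Rightarrow> real) \<Rightarrow> real \<Rightarrow> real" where
  "caputo \<mu> v t = 1 / Gamma (1 - \<mu>) * deriv (caputo_prim \<mu> v) t"

definition caputo_on :: "real \<Rightarrow> real \<Rightarrow> (real \<Rightarrow> real) \<Rightarrow> (real \<Rightarrow> real) \<Rightarrow> bool" where
  "caputo_on \<tau> \<mu> v w \<longleftrightarrow> continuous_on {0..\<tau>} w \<and>
     (\<forall>t\<in>{0<..<\<tau>}. caputo_prim \<mu> v field_differentiable at t \<and> caputo \<mu> v t = w t)"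

definition holder_on :: "real \<Rightarrow> 'a::metric_space set \<Rightarrow> ('a \<Rightarrow> real) \<Rightarrow> bool" where
  "holder_on \<alpha> S f \<longleftrightarrow> (\<exists>C. \<forall>x\<in>S. \<forall>y\<in>S. \<bar>f x - f y\<bar> \<le> C * dist x y powr \<alpha>)"

definition partial_deriv :: "'n::finite \<Rightarrow> (real^'n \<Rightarrow> real) \<Rightarrow> real^'n \<Rightarrow> real" where
  "partial_deriv i f x = frechet_derivative f (at x) (axis i 1)"

definition twice_differentiable_on :: "(real^'n::finite \<Rightarrow> real) \<Rightarrow> (real^'n) set \<Rightarrow> bool" where
  "twice_differentiable_on f \<Omega> \<longleftrightarrow>
     (\<forall>x\<in>\<Omega>. f differentiable (at x) \<and> (\<forall>i. partial_deriv i f differentiable (at x)))"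

text \<open>Continuity on \<open>\<Omega> \<times> I\<close> with continuous extension to \<open>closure \<Omega> \<times> I\<close>.\<close>

definition cont_ext :: "'a::topological_space set \<Rightarrow> real set \<Rightarrow> ('a \<Rightarrow> real \<Rightarrow> real) \<Rightarrow> bool" where
  "cont_ext \<Omega> I f \<longleftrightarrow> (\<exists>F. continuous_on (closure \<Omega> \<times> I) (\<lambda>(x, t). F x t) \<and>
     (\<forall>x\<in>\<Omega>. \<forall>t\<in>I. F x t = f x t))"

definition C2_space :: "(real^'n::finite) set \<Rightarrow> real set \<Rightarrow> (real^'n \<Rightarrow> real \<Rightarrow> real) \<Rightarrow> bool" where
  "C2_space \<Omega> I u \<longleftrightarrow>
     continuous_on (closure \<Omega> \<times> I) (\<lambda>(x, t). u x t) \<and>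
     (\<forall>t\<in>I. twice_differentiable_on (\<lambda>x. u x t) \<Omega>) \<and>
     (\<forall>i. cont_ext \<Omega> I (\<lambda>x t. partial_deriv i (\<lambda>y. u y t) x)) \<and>
     (\<forall>i j. cont_ext \<Omega> I (\<lambda>x t. partial_deriv i (partial_deriv j (\<lambda>y. u y t)) x))"

definition C2_closure :: "(real^'n::finite) set \<Rightarrow> (real^'n \<Rightarrow> real) \<Rightarrow> bool" where
  "C2_closure \<Omega> v \<longleftrightarrow> C2_space \<Omega> {0} (\<lambda>x t. v x)"

text \<open>Value of a function given on \<open>\<Omega>\<close>, continuously extended to boundary points.\<close>

definition up_to_bdry :: "'a::t2_space set \<Rightarrow> ('a \<Rightarrow> real) \<Rightarrow> 'a \<Rightarrow> real" where
  "up_to_bdry \<Omega> f x = (if x \<in> \<Omega> then f x else Lim (at x within \<Omega>) f)"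

text \<open>The derivatives of \<open>v\<close> at boundary points of \<open>\<Omega>\<close> are understood by continuous extension.\<close>

definition second_order_op ::
  "(real^'n::finite) set \<Rightarrow> ('n \<Rightarrow> 'n \<Rightarrow> real^'n \<Rightarrow> real \<Rightarrow> real) \<Rightarrow>
   ('n \<Rightarrow> real^'n \<Rightarrow> real \<Rightarrow> real) \<Rightarrow> (real^'n \<Rightarrow> real \<Rightarrow> real) \<Rightarrow>
   (real^'n \<Rightarrow> real) \<Rightarrow> real^'n \<Rightarrow> real \<Rightarrow> real" where
  "second_order_op \<Omega> a2 a1 a0 v x t =
     (\<Sum>i\<in>UNIV. \<Sum>j\<in>UNIV. a2 i j x t * up_to_bdry \<Omega> (partial_deriv i (partial_deriv j v)) x) +
     (\<Sum>i\<in>UNIV. a1 i x t * up_to_bdry \<Omega> (partial_deriv i v) x) + a0 x t * v x"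

text \<open>Near the boundary point \<open>p\<close>, \<open>\<Omega>\<close> is the part of the ball lying, in the direction of the unit
  vector \<open>e\<close>, above the graph of a function of class \<open>C\<^sup>2\<^sup>+\<^sup>\<alpha>\<close> on the hyperplane orthogonal to \<open>e\<close>.
  A function on that hyperplane is encoded as a function \<open>\<gamma>\<close> on the whole space that is constant in
  the direction \<open>e\<close>.\<close>

definition graph_chart ::
  "real \<Rightarrow> (real^'n::finite) set \<Rightarrow> real^'n \<Rightarrow> real \<Rightarrow> real^'n \<Rightarrow> (real^'n \<Rightarrow> real) \<Rightarrow> bool" where
  "graph_chart \<alpha> \<Omega> p \<rho> e \<gamma> \<longleftrightarrow>
     \<rho> > 0 \<and> norm e = 1 \<and> (\<forall>x s. \<gamma> (x + s *\<^sub>R e) = \<gamma> x) \<and>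
     twice_differentiable_on \<gamma> (ball p \<rho>) \<and>
     (\<forall>i j. holder_on \<alpha> (ball p \<rho>) (partial_deriv i (partial_deriv j \<gamma>))) \<and>
     \<Omega> \<inter> ball p \<rho> = {x \<in> ball p \<rho>. \<gamma> x < x \<bullet> e}"

definition bounded_C2_domain :: "real \<Rightarrow> (real^'n::finite) set \<Rightarrow> bool" where
  "bounded_C2_domain \<alpha> \<Omega> \<longleftrightarrow> open \<Omega> \<and> connected \<Omega> \<and> \<Omega> \<noteq> {} \<and> bounded \<Omega> \<and>
     (\<forall>p\<in>frontier \<Omega>. \<exists>\<rho> e \<gamma>. graph_chart \<alpha> \<Omega> p \<rho> e \<gamma>)"

definition outward_unit_normal :: "real \<Rightarrow> (real^'n::finite) set \<Rightarrow> real^'n \<Rightarrow> real^'n \<Rightarrow> bool" where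
  "outward_unit_normal \<alpha> \<Omega> p N \<longleftrightarrow> (\<exists>\<rho> e \<gamma>. graph_chart \<alpha> \<Omega> p \<rho> e \<gamma> \<and>
     (let m = (\<chi> i. partial_deriv i \<gamma> p) - e in N = (1 / norm m) *\<^sub>R m))"

datatype operator_type = TypeI | TypeII

text \<open>The observation comes with the coefficients \<open>r\<^sub>i\<close> of the fractional operator, which may depend
  on the space variable for the local observation only.\<close>

datatype 'x observation =
    LO 'x "nat \<Rightarrow> 'x \<Rightarrow> real \<Rightarrow> real"
  | NLO "nat \<Rightarrow> real \<Rightarrow> real"

text \<open>All data of the problem except the orders, the horizon \<open>T\<close> and the observed function \<open>\<psi>\<close>.
  \<open>obl_coef\<close> (the first-order coefficients \<open>c\<^sub>i\<close> of \<open>\<N>\<^sub>1\<close>) and \<open>bdry_kernel\<close>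
  (\<open>\<K>\<^sub>1\<close>) belong to the boundary condition and do not enter the equation.\<close>

record ('n::finite) problem =
  Omega :: "(real^'n) set"
  coef_a2 :: "'n \<Rightarrow> 'n \<Rightarrow> real^'n \<Rightarrow> real \<Rightarrow> real"
  coef_a1 :: "'n \<Rightarrow> real^'n \<Rightarrow> real \<Rightarrow> real"
  coef_a0 :: "real^'n \<Rightarrow> real \<Rightarrow> real"
  coef_b2 :: "'n \<Rightarrow> 'n \<Rightarrow> real^'n \<Rightarrow> real \<Rightarrow> real"
  coef_b1 :: "'n \<Rightarrow> real^'n \<Rightarrow> real \<Rightarrow> real"
  coef_b0 :: "real^'n \<Rightarrow> real \<Rightarrow> real"
  obl_coef :: "'n \<Rightarrow> real^'n \<Rightarrow> real \<Rightarrow> real"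
  mem_kernel :: "real \<Rightarrow> real"
  bdry_kernel :: "real \<Rightarrow> real"
  nonlin :: "real \<Rightarrow> real"
  source :: "real^'n \<Rightarrow> real \<Rightarrow> real"
  init_val :: "real^'n \<Rightarrow> real"
  op_type :: operator_type
  top_index :: nat
  obs :: "(real^'n) observation"

definition L1 :: "('n::finite) problem \<Rightarrow> (real^'n \<Rightarrow> real) \<Rightarrow> real^'n \<Rightarrow> real \<Rightarrow> real" where
  "L1 P = second_order_op (Omega P) (coef_a2 P) (coef_a1 P) (coef_a0 P)"

definition L2 :: "('n::finite) problem \<Rightarrow> (real^'n \<Rightarrow> real) \<Rightarrow> real^'n \<Rightarrow> real \<Rightarrow> real" where
  "L2 P = second_order_op (Omega P) (coef_b2 P) (coef_b1 P) (coef_b0 P)"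

definition r_coef :: "('n::finite) problem \<Rightarrow> nat \<Rightarrow> real^'n \<Rightarrow> real \<Rightarrow> real" where
  "r_coef P i x t = (case obs P of LO x0 r \<Rightarrow> r i x t | NLO r \<Rightarrow> r i t)"

definition dt_arg :: "('n::finite) problem \<Rightarrow> nat \<Rightarrow> (real^'n \<Rightarrow> real \<Rightarrow> real) \<Rightarrow> real^'n \<Rightarrow> real \<Rightarrow> real" where
  "dt_arg P i u x t = (case op_type P of TypeI \<Rightarrow> u x t | TypeII \<Rightarrow> r_coef P i x t * u x t)"

definition Dt :: "('n::finite) problem \<Rightarrow> (nat \<Rightarrow> real) \<Rightarrow> (real^'n \<Rightarrow> real \<Rightarrow> real) \<Rightarrow> real^'n \<Rightarrow> real \<Rightarrow> real" where
  "Dt P \<nu> u x t = (case op_type P of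
      TypeI \<Rightarrow> (\<Sum>i\<le>top_index P. r_coef P i x t * caputo (\<nu> i) (dt_arg P i u x) t)
    | TypeII \<Rightarrow> (\<Sum>i\<le>top_index P. caputo (\<nu> i) (dt_arg P i u x) t))"

definition classical_solution ::
  "('n::finite) problem \<Rightarrow> real \<Rightarrow> (nat \<Rightarrow> real) \<Rightarrow> (real^'n \<Rightarrow> real \<Rightarrow> real) \<Rightarrow> bool" where
  "classical_solution P \<tau> \<nu> u \<longleftrightarrow>
     C2_space (Omega P) {0..\<tau>} u \<and>
     (\<forall>i\<le>top_index P. \<exists>W. continuous_on (closure (Omega P) \<times> {0..\<tau>}) (\<lambda>(x, t). W x t) \<and>
        (\<forall>x\<in>closure (Omega P). caputo_on \<tau> (\<nu> i) (dt_arg P i u x) (W x))) \<and>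
     (\<forall>x\<in>Omega P. \<forall>t\<in>{0<..<\<tau>}.
        Dt P \<nu> u x t - L1 P (\<lambda>y. u y t) x t
          - tconv (mem_kernel P) (\<lambda>s. L2 P (\<lambda>y. u y s) x s) t + nonlin P (u x t)
        = source P x t) \<and>
     (\<forall>x\<in>closure (Omega P). u x 0 = init_val P x)"

definition operators_admissible :: "('n::finite) problem \<Rightarrow> real \<Rightarrow> real \<Rightarrow> bool" where
  "operators_admissible P \<alpha> T \<longleftrightarrow>
     (\<exists>\<delta>1 \<delta>2. 0 < \<delta>1 \<and> \<delta>1 < \<delta>2 \<and>
        (\<forall>x\<in>closure (Omega P). \<forall>t\<in>{0..T}. \<forall>\<xi>.
           \<delta>1 * (norm \<xi>)\<^sup>2 \<le> (\<Sum>i\<in>UNIV. \<Sum>j\<in>UNIV. coef_a2 P i j x t * \<xi> $ i * \<xi> $ j) \<and>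
           (\<Sum>i\<in>UNIV. \<Sum>j\<in>UNIV. coef_a2 P i j x t * \<xi> $ i * \<xi> $ j) \<le> \<delta>2 * (norm \<xi>)\<^sup>2)) \<and>
     (\<exists>\<delta>3>0. \<forall>x\<in>frontier (Omega P). \<forall>N. outward_unit_normal \<alpha> (Omega P) x N \<longrightarrow>
        (\<forall>t\<in>{0..T}. \<delta>3 \<le> (\<Sum>i\<in>UNIV. obl_coef P i x t * N $ i)))"

definition orders_admissible :: "real \<Rightarrow> nat \<Rightarrow> (nat \<Rightarrow> real) \<Rightarrow> bool" where
  "orders_admissible \<alpha> M \<nu> \<longleftrightarrow>
     (\<forall>i\<le>M. 0 < \<nu> i \<and> \<nu> i < 1) \<and> (\<forall>i<M. \<nu> (Suc i) < \<nu> i) \<and>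
     (1 \<le> M \<longrightarrow> \<nu> 1 < \<nu> 0 * (2 - \<alpha>) / 2)"

text \<open>Besides \<open>r\<^sub>0 \<ge> \<delta>\<^sub>4\<close>: for type I the coefficients \<open>r\<^sub>i\<close> are continuous on \<open>closure \<Omega> \<times> [0,T]\<close>, for
  type II they are of class \<open>C(closure \<Omega>, C\<^sup>1[0,T])\<close>, that is, \<open>r\<^sub>i\<close> and its time derivative
  are continuous on \<open>closure \<Omega> \<times> [0,T]\<close>. When \<open>r\<^sub>i\<close> does not depend on \<open>x\<close> these are the
  classes \<open>C[0,T]\<close> and \<open>C\<^sup>1[0,T]\<close>.\<close>

definition r_admissible :: "('n::finite) problem \<Rightarrow> real \<Rightarrow> bool" where
  "r_admissible P T \<longleftrightarrow>
     (\<exists>\<delta>4>0. \<forall>x\<in>closure (Omega P). \<forall>t\<in>{0..T}. \<delta>4 \<le> r_coef P 0 x t) \<and>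
     (\<forall>i\<le>top_index P.
        continuous_on (closure (Omega P) \<times> {0..T}) (\<lambda>(x, t). r_coef P i x t) \<and>
        (op_type P = TypeII \<longrightarrow>
          (\<exists>r'. continuous_on (closure (Omega P) \<times> {0..T}) (\<lambda>(x, t). r' x t) \<and>
             (\<forall>x\<in>closure (Omega P). \<forall>t\<in>{0..T}.
                (r_coef P i x has_real_derivative r' x t) (at t within {0..T})))))"

definition kernels_admissible :: "('n::finite) problem \<Rightarrow> real \<Rightarrow> bool" where
  "kernels_admissible P T \<longleftrightarrow>
     mem_kernel P absolutely_integrable_on {0<..<T} \<and>
     bdry_kernel P absolutely_integrable_on {0<..<T}"

definition observed_regular :: "real \<Rightarrow> nat \<Rightarrow> (nat \<Rightarrow> real) \<Rightarrow> (real \<Rightarrow> real) \<Rightarrow> bool" where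
  "observed_regular \<tau> M \<nu> \<psi> \<longleftrightarrow> continuous_on {0..\<tau>} \<psi> \<and>
     (\<forall>i\<le>M. \<exists>w \<beta>. 0 < \<beta> \<and> \<beta> \<le> 1 \<and> caputo_on \<tau> (\<nu> i) \<psi> w \<and> holder_on \<beta> {0..\<tau>} w)"

definition data_regular :: "('n::finite) problem \<Rightarrow> real \<Rightarrow> bool" where
  "data_regular P T \<longleftrightarrow>
     (let Q = closure (Omega P) \<times> {0..T} in
        (\<forall>i j. continuous_on Q (\<lambda>(x, t). coef_a2 P i j x t) \<and>
               continuous_on Q (\<lambda>(x, t). coef_b2 P i j x t)) \<and>
        (\<forall>i. continuous_on Q (\<lambda>(x, t). coef_a1 P i x t) \<and>
             continuous_on Q (\<lambda>(x, t). coef_b1 P i x t)) \<and>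
        continuous_on Q (\<lambda>(x, t). coef_a0 P x t) \<and>
        continuous_on Q (\<lambda>(x, t). coef_b0 P x t) \<and>
        continuous_on Q (\<lambda>(x, t). source P x t)) \<and>
     C2_closure (Omega P) (init_val P) \<and> continuous_on UNIV (nonlin P)"

definition observed :: "('n::finite) problem \<Rightarrow> (real^'n \<Rightarrow> real) \<Rightarrow> real" where
  "observed P v = (case obs P of LO x0 r \<Rightarrow> v x0 | NLO r \<Rightarrow> integral (Omega P) v)"

definition obs_weight :: "('n::finite) problem \<Rightarrow> real \<Rightarrow> real" where
  "obs_weight P t = (case obs P of LO x0 r \<Rightarrow> r 0 x0 t | NLO r \<Rightarrow> r 0 t)"

definition obs_point_admissible :: "('n::finite) problem \<Rightarrow> bool" where
  "obs_point_admissible P \<longleftrightarrow> (case obs P of LO x0 r \<Rightarrow> x0 \<in> closure (Omega P) | NLO r \<Rightarrow> True)"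

definition C0_const :: "('n::finite) problem \<Rightarrow> real" where
  "C0_const P = (case obs P of
      LO x0 r \<Rightarrow> source P x0 0 - nonlin P (init_val P x0) + L1 P (init_val P) x0 0
    | NLO r \<Rightarrow> integral (Omega P) (\<lambda>x. L1 P (init_val P) x 0)
        - integral (Omega P) (\<lambda>x. nonlin P (init_val P x))
        + integral (Omega P) (\<lambda>x. source P x 0))"

text \<open>\<open>\<psi>\<close> is the observation, on \<open>[0,\<tau>]\<close>, of the solution \<open>u\<close> of the problem with orders \<open>\<nu>\<close>.
  Without a boundary condition the equation is not uniquely solvable, and the global solution need
  not be classical: \<open>sol \<nu> v\<close> stands for ``\<open>v\<close> is a solution in \<open>\<Omega> \<times> (0,T)\<close> of the problem with
  orders \<open>\<nu>\<close>'', where the boundary condition and the sense of solution are arbitrary.\<close>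

definition order_observation ::
  "('n::finite) problem \<Rightarrow> real \<Rightarrow> real \<Rightarrow> real \<Rightarrow>
   ((nat \<Rightarrow> real) \<Rightarrow> (real^'n \<Rightarrow> real \<Rightarrow> real) \<Rightarrow> bool) \<Rightarrow>
   (real \<Rightarrow> real) \<Rightarrow> (nat \<Rightarrow> real) \<Rightarrow> (real^'n \<Rightarrow> real \<Rightarrow> real) \<Rightarrow> bool" where
  "order_observation P \<alpha> T \<tau> sol \<psi> \<nu> u \<longleftrightarrow>
     orders_admissible \<alpha> (top_index P) \<nu> \<and>
     observed_regular \<tau> (top_index P) \<nu> \<psi> \<and>
     sol \<nu> u \<and> (\<forall>v. sol \<nu> v \<longrightarrow> (\<forall>x\<in>Omega P. \<forall>t\<in>{0<..<T}. v x t = u x t)) \<and>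
     classical_solution P \<tau> \<nu> u \<and>
     (\<forall>t\<in>{0..\<tau>}. observed P (\<lambda>x. u x t) = \<psi> t)"

end

theory Submission
  imports Defs
begin

text \<open>Let \<open>v\<close> be the function observed through the operator of leading order: \<open>\<psi>\<close> for type I,
  \<open>r \<psi>\<close> for type II. It suffices that \<open>v(t) - v(0) = A t\<^sup>\<nu>\<^sup>0 (1 + o(1))\<close> with \<open>A \<noteq> 0\<close>, since then
  \<open>t (v(t) - v(0))\<close> divided by the integral of \<open>v - v(0)\<close> over \<open>[0,t]\<close> tends to \<open>1 + \<nu>\<^sub>0\<close>.
  The expansion holds whenever the Caputo derivative of order \<open>\<nu>\<^sub>0\<close> of \<open>v\<close> extends continuously to
  \<open>t = 0\<close>, and \<open>A\<close> is then the value at \<open>0\<close> divided by \<open>\<Gamma>(1 + \<nu>\<^sub>0)\<close>. Instead of inverting the fractional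
  integral, this follows from a comparison principle: a nonnegative Caputo derivative
  implies \<open>v(t) \<ge> v(0)\<close>, and one compares with multiples of \<open>t\<^sup>\<mu>\<close>. The estimate depends only on the
  oscillation of the derivative near \<open>0\<close>, hence is uniform in \<open>x\<close>
  and can be integrated over \<open>\<Omega>\<close>. By the expansion the increments are \<open>O(t\<^sup>\<nu>\<^sup>0)\<close>, so the Caputo
  derivatives of lower order vanish at \<open>t = 0\<close>. Letting \<open>t\<close> tend to \<open>0\<close> in the equation, the memory
  term disappears as well, and the observed value of the remaining equation is the constant \<open>C\<^sub>0\<close>.\<close>

section \<open>Abel integrals\<close>

lemma has_integral_reflect_Icc:
  fixes g :: "real \<Rightarrow> real"
  assumes "(g has_integral I) {0..t}"
  shows "((\<lambda>s. g (t - s)) has_integral I) {0..t}"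
proof -
  have "((\<lambda>s. g (-1 *\<^sub>R s + t)) has_integral (1 / (\<bar>-1::real\<bar> ^ DIM(real))) *\<^sub>R I)
      ((\<lambda>x. (1 / -1) *\<^sub>R x + -((1 / -1) *\<^sub>R t)) ` cbox 0 t)"
    using assms by (intro has_integral_affinity) auto
  moreover have "(\<lambda>x. (1 / -1) *\<^sub>R x + -((1 / -1) *\<^sub>R t)) ` cbox 0 t = {0..t}"
    by (auto simp: image_iff intro!: bexI[of _ "t - _"])
  ultimately show ?thesis by (simp add: algebra_simps)
qed

text \<open>The affine map carrying \<open>{r..t}\<close> onto \<open>{0..1}\<close> reduces this to
  the Beta integral. The Jacobian \<open>1 / m\<close> contributes one factor \<open>t - r\<close>,
  and undoing the scaling of the two powers contributes the exponent
  \<open>a + b - 2\<close>.\<close>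

lemma has_integral_Beta_Icc:
  fixes a b r t :: real
  assumes "a > 0" "b > 0" "r < t"
  shows "((\<lambda>s. (t - s) powr (a - 1) * (s - r) powr (b - 1)) has_integral
           Beta b a * (t - r) powr (a + b - 1)) {r..t}"
proof -
  define m where "m = 1 / (t - r)"
  have m: "m > 0" using assms by (simp add: m_def)
  have ends: "(0 - - r * m) /\<^sub>R m = r" "(1 - - r * m) /\<^sub>R m = t"
    using assms by (auto simp: m_def field_simps)
  let ?f = "\<lambda>x. x powr (b - 1) * (1 - x) powr (a - 1)"
  have "(?f has_integral Beta b a) (cbox 0 1)"
    using has_integral_Beta_real[of b a] assms unfolding box_real by simp
  from has_integral_affinity'[OF this m, of "- r * m"]
  have "((\<lambda>s. ?f (m * s - r * m)) has_integral Beta b a / m) {r..t}"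
    unfolding interval_cbox[symmetric] ends by (simp add: divide_inverse mult.commute)
  from has_integral_mult_left[OF this, of "(t - r) powr (a + b - 2)"]
  have "((\<lambda>s. ?f (m * s - r * m) * (t - r) powr (a + b - 2)) has_integral
      Beta b a / m * (t - r) powr (a + b - 2)) {r..t}" .
  moreover have "Beta b a / m * (t - r) powr (a + b - 2) = Beta b a * (t - r) powr (a + b - 1)"
    using assms powr_mult_base[of "t - r" "a + b - 2"] by (simp add: m_def)
  moreover have cong: "?f (m * s - r * m) * (t - r) powr (a + b - 2) =
      (t - s) powr (a - 1) * (s - r) powr (b - 1)" if "s \<in> {r..t}" for s
  proof -
    have eq: "m * s - r * m = (s - r) / (t - r)" by (simp add: m_def diff_divide_distrib)
    have eq': "1 - (m * s - r * m) = (t - s) / (t - r)"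
      unfolding eq using assms by (simp add: field_simps)
    have split: "(t - r) powr (a + b - 2) = (t - r) powr (a - 1) * (t - r) powr (b - 1)"
      by (simp flip: powr_add)
    have "(t - r) powr (a - 1) \<noteq> 0" "(t - r) powr (b - 1) \<noteq> 0" using assms by auto
    then show ?thesis
      unfolding eq' split unfolding eq using that assms
      by (subst (1 2) powr_divide) simp_all
  qed
  ultimately show ?thesis
    by (simp only: has_integral_cong[OF cong])
qed

text \<open>The integrand is dominated by \<open>B\<close> times the kernel, which is integrable up
  to its singularity at \<open>r = s\<close> because \<open>\<mu> < 1\<close>. The Lebesgue form
  feeds Fubini's theorem; the bound makes the Caputo primitive vanish at time 0.\<close>

lemma abel_kernel_integrable:
  fixes f :: "real \<Rightarrow> real"
  assumes [measurable]: "f \<in> borel_measurable borel" and B: "\<And>r. \<bar>f r\<bar> \<le> B"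
    and "\<mu> < 1" "0 \<le> s"
  shows "set_integrable lborel {0..s} (\<lambda>r. f r / (s - r) powr \<mu>)"
    and "\<bar>integral {0..s} (\<lambda>r. f r / (s - r) powr \<mu>)\<bar> \<le> B * (s powr (1 - \<mu>) / (1 - \<mu>))"
proof -
  define h where "h = (\<lambda>r. f r / (s - r) powr \<mu>)"
  define p where "p = (\<lambda>r. indicator {0..s} r * (s - r) powr (-\<mu>))"
  have [measurable]: "p \<in> borel_measurable borel" "h \<in> borel_measurable borel"
    unfolding p_def h_def by measurable
  have "((\<lambda>r. r powr (- \<mu>)) has_integral (s powr (- \<mu> + 1) / (- \<mu> + 1))) {0..s}"
    using assms by (intro has_integral_powr_from_0) auto
  from has_integral_reflect_Icc[OF this]
  have kernel: "((\<lambda>r. (s - r) powr (- \<mu>)) has_integral (s powr (- \<mu> + 1) / (- \<mu> + 1))) {0..s}" .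
  then have "((\<lambda>r. if r \<in> {0..s} then (s - r) powr (- \<mu>) else 0) has_integral
      (s powr (- \<mu> + 1) / (- \<mu> + 1))) UNIV"
    by (simp only: has_integral_restrict_UNIV)
  also have "(\<lambda>r. if r \<in> {0..s} then (s - r) powr (- \<mu>) else 0) = p"
    by (auto simp: p_def)
  finally have "integral\<^sup>N lborel p = ennreal (s powr (- \<mu> + 1) / (- \<mu> + 1))"
    by (intro nn_integral_has_integral_lborel) (auto simp: p_def)
  then have "has_bochner_integral lborel p (s powr (- \<mu> + 1) / (- \<mu> + 1))"
    using assms by (intro has_bochner_integral_nn_integral) (auto simp: p_def)
  then have "integrable lborel p" by (simp add: has_bochner_integral_iff)
  then have pB: "integrable lborel (\<lambda>r. p r * B)" by simp
  have "\<bar>f r\<bar> \<le> \<bar>B\<bar>" for r using B[of r] by linarith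
  then have "norm (indicator {0..s} r * h r) \<le> norm (p r * B)" for r
    by (auto simp: h_def p_def indicator_def powr_minus_divide abs_mult intro!: divide_right_mono)
  then have "integrable lborel (\<lambda>r. indicator {0..s} r * h r)"
    using pB by (rule_tac Bochner_Integration.integrable_bound[of lborel "\<lambda>r. p r * B"]) auto
  then show h: "set_integrable lborel {0..s} (\<lambda>r. f r / (s - r) powr \<mu>)"
    by (simp add: set_integrable_def h_def)
  have int: "((\<lambda>r. B * (s - r) powr (- \<mu>)) has_integral B * (s powr (- \<mu> + 1) / (- \<mu> + 1))) {0..s}"
    by (intro has_integral_mult_right kernel)
  have "norm (integral {0..s} (\<lambda>r. f r / (s - r) powr \<mu>)) \<le> integral {0..s} (\<lambda>r. B * (s - r) powr (- \<mu>))"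
    using B int set_borel_integral_eq_integral(1)[OF h]
    by (intro integral_norm_bound_integral)
      (auto simp: powr_minus_divide has_integral_integrable intro!: divide_right_mono)
  also have "\<dots> = B * (s powr (- \<mu> + 1) / (- \<mu> + 1))"
    using int by (rule integral_unique)
  finally show "\<bar>integral {0..s} (\<lambda>r. f r / (s - r) powr \<mu>)\<bar> \<le> B * (s powr (1 - \<mu>) / (1 - \<mu>))"
    by simp
qed

text \<open>Abel's inversion: the kernels \<open>s\<^sup>\<mu>\<^sup>-\<^sup>1\<close> and \<open>s\<^sup>-\<^sup>\<mu>\<close> convolve to the constant \<open>Beta (1 - \<mu>) \<mu>\<close>.\<close>

lemma abel_fubini:
  fixes f :: "real \<Rightarrow> real"
  assumes f [measurable]: "f \<in> borel_measurable borel" and B: "\<And>r. \<bar>f r\<bar> \<le> B"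
    and \<mu>: "0 < \<mu>" "\<mu> < 1"
  shows "((\<lambda>s. (t - s) powr (\<mu> - 1) * integral {0..s} (\<lambda>r. f r / (s - r) powr \<mu>))
           has_integral Beta (1 - \<mu>) \<mu> * integral {0..t} f) {0..t}"
proof -
  \<comment> \<open>The kernel lives on the triangle \<open>0 \<le> r \<le> s \<le> t\<close> and is
    extended by zero, so that Fubini's theorem can be used on the whole plane.\<close>
  define k where "k = (\<lambda>r s. if 0 \<le> r \<and> r \<le> s \<and> s \<le> t
    then (t - s) powr (\<mu> - 1) * (s - r) powr ((1 - \<mu>) - 1) else 0)"
  define G where "G = (\<lambda>r s. k r s * f r)"
  define b where "b = Beta (1 - \<mu>) \<mu>"
  have [measurable]: "case_prod k \<in> borel_measurable (lborel \<Otimes>\<^sub>M lborel)"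
    unfolding k_def case_prod_beta by measurable
  have [measurable]: "k r \<in> borel_measurable borel" for r
    unfolding k_def by measurable
  have [measurable]: "case_prod G \<in> borel_measurable (lborel \<Otimes>\<^sub>M lborel)"
    unfolding G_def case_prod_beta k_def by measurable
  have k_nonneg: "0 \<le> k r s" for r s by (simp add: k_def)
  \<comment> \<open>The exponents \<open>\<mu>\<close> and \<open>1 - \<mu>\<close> add up to 1, so
    the power of \<open>t - r\<close> disappears and the integral over \<open>s\<close> is the same
    \<open>b\<close> for every \<open>r\<close>.\<close>
  have k: "has_bochner_integral lborel (k r) b" if "r \<in> {0..<t}" for r
  proof -
    have "((\<lambda>s. (t - s) powr (\<mu> - 1) * (s - r) powr ((1 - \<mu>) - 1)) has_integral b) {r..t}"
      using has_integral_Beta_Icc[of \<mu> "1 - \<mu>" r t] \<mu> that by (simp add: b_def)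
    moreover have "k r = (\<lambda>s. if s \<in> {r..t} then (t - s) powr (\<mu> - 1) * (s - r) powr ((1 - \<mu>) - 1) else 0)"
      using that by (auto simp: k_def)
    ultimately have int: "(k r has_integral b) UNIV"
      by (simp only: has_integral_restrict_UNIV)
    show ?thesis
    proof (rule has_bochner_integral_nn_integral)
      show "integral\<^sup>N lborel (\<lambda>s. ennreal (k r s)) = ennreal b"
        using int k_nonneg by (intro nn_integral_has_integral_lborel) auto
      show "0 \<le> b" by (rule has_integral_nonneg[OF int]) (rule k_nonneg)
    qed (auto simp: k_nonneg)
  qed
  have k0: "k r s = 0" if "r \<notin> {0..t}" for r s using that by (auto simp: k_def)
  \<comment> \<open>At \<open>r = t\<close> the slice of the triangle is a single point and the
    inner integral is 0 instead of \<open>b * f t\<close>; this null set is discarded.\<close>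
  have AE: "AE r in lborel. r \<noteq> t" by (rule AE_lborel_singleton)
  have f_int: "integrable lborel (\<lambda>r. indicator {0..t} r * f r)"
  proof (rule Bochner_Integration.integrable_bound)
    show "integrable lborel (\<lambda>r. indicator {0..t} r * B)"
      by (intro integrable_mult_left integrable_real_indicator) (auto simp: emeasure_lborel_Icc_eq)
    have "\<bar>f r\<bar> \<le> \<bar>B\<bar>" for r using B[of r] by linarith
    then show "AE r in lborel. norm (indicator {0..t} r * f r) \<le> norm (indicator {0..t} r * B)"
      by (auto simp: indicator_def)
  qed simp
  have inner_f: "(\<integral>s. G r s \<partial>lborel) = b * (indicator {0..t} r * f r)"
    and inner_abs: "(\<integral>s. \<bar>G r s\<bar> \<partial>lborel) = b * \<bar>indicator {0..t} r * f r\<bar>"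
    and inner_int: "integrable lborel (G r)" if "r \<noteq> t" for r
  proof -
    have "(\<integral>s. G r s \<partial>lborel) = b * (indicator {0..t} r * f r) \<and>
      (\<integral>s. \<bar>G r s\<bar> \<partial>lborel) = b * \<bar>indicator {0..t} r * f r\<bar> \<and> integrable lborel (G r)"
    proof (cases "r \<in> {0..<t}")
      case True
      from k[OF True] True show ?thesis
        by (auto simp: G_def has_bochner_integral_iff abs_mult k_nonneg)
    next
      case False
      with that have "r \<notin> {0..t}" by auto
      then show ?thesis by (simp add: G_def k0)
    qed
    then show "(\<integral>s. G r s \<partial>lborel) = b * (indicator {0..t} r * f r)"
      "(\<integral>s. \<bar>G r s\<bar> \<partial>lborel) = b * \<bar>indicator {0..t} r * f r\<bar>" "integrable lborel (G r)"
      by auto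
  qed
  have G_int: "integrable (lborel \<Otimes>\<^sub>M lborel) (case_prod G)"
  proof (rule lborel_pair.Fubini_integrable)
    have "integrable lborel (\<lambda>r. b * \<bar>indicator {0..t} r * f r\<bar>)"
      using f_int by (intro integrable_mult_right integrable_abs)
    moreover have eq: "AE r in lborel. (\<integral>s. norm (case_prod G (r, s)) \<partial>lborel) =
        b * \<bar>indicator {0..t} r * f r\<bar>"
      using AE by eventually_elim (simp add: inner_abs)
    ultimately show "integrable lborel (\<lambda>r. \<integral>s. norm (case_prod G (r, s)) \<partial>lborel)"
      by (subst integrable_cong_AE[OF _ _ eq]) simp_all
    show "AE r in lborel. integrable lborel (\<lambda>s. case_prod G (r, s))"
      using AE by eventually_elim (simp add: inner_int)
  qed simp
  define Q where "Q = (\<lambda>s. \<integral>r. G r s \<partial>lborel)"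
  have "integral\<^sup>L lborel Q = (\<integral>r. (\<integral>s. G r s \<partial>lborel) \<partial>lborel)"
    unfolding Q_def by (rule lborel_pair.Fubini_integral[OF G_int])
  also have "\<dots> = (\<integral>r. b * (indicator {0..t} r * f r) \<partial>lborel)"
  proof (rule integral_cong_AE)
    show "AE r in lborel. (\<integral>s. G r s \<partial>lborel) = b * (indicator {0..t} r * f r)"
      using AE by eventually_elim (rule inner_f)
  qed simp_all
  also have "\<dots> = b * integral {0..t} f"
    using set_borel_integral_eq_integral(2)[of "{0..t}" f] f_int
    by (simp add: set_integrable_def set_lebesgue_integral_def)
  finally have Q_val: "integral\<^sup>L lborel Q = b * integral {0..t} f" .
  have Q_int: "integrable lborel Q"
    using lborel_pair.integrable_snd[OF G_int] by (simp add: Q_def)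
  \<comment> \<open>Integrating over \<open>r\<close> first gives the Abel integral of
    \<open>f\<close>, which is the other side of the identity.\<close>
  have Q_eq: "Q s = (t - s) powr (\<mu> - 1) * integral {0..s} (\<lambda>r. f r / (s - r) powr \<mu>)"
    if "s \<in> {0..t}" for s
  proof -
    define h where "h = (\<lambda>r. f r / (s - r) powr \<mu>)"
    have "Q s = (\<integral>r. (t - s) powr (\<mu> - 1) * (indicator {0..s} r * h r) \<partial>lborel)"
      unfolding Q_def G_def k_def h_def using that
      by (intro Bochner_Integration.integral_cong) (auto simp: powr_minus_divide indicator_def)
    also have "\<dots> = (t - s) powr (\<mu> - 1) * (\<integral>r. indicator {0..s} r * h r \<partial>lborel)" by simp
    also have "(\<integral>r. indicator {0..s} r * h r \<partial>lborel) = integral {0..s} h"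
      using set_borel_integral_eq_integral(2)[OF abel_kernel_integrable(1)[OF f B \<mu>(2), of s]] that
      by (simp add: set_lebesgue_integral_def h_def)
    finally show ?thesis by (simp add: h_def)
  qed
  have "Q s = 0" if "s \<notin> {0..t}" for s
  proof -
    have "G r s = 0" for r using that by (auto simp: G_def k_def)
    then show ?thesis by (simp add: Q_def)
  qed
  then have "Q = (\<lambda>s. if s \<in> {0..t} then Q s else 0)" by auto
  then have "((\<lambda>s. if s \<in> {0..t} then Q s else 0) has_integral b * integral {0..t} f) UNIV"
    using has_integral_integral_lborel[OF Q_int] Q_val by simp
  then have "(Q has_integral b * integral {0..t} f) {0..t}"
    by (simp only: has_integral_restrict_UNIV)
  then show ?thesis
    unfolding b_def by (simp only: has_integral_cong[OF Q_eq])
qed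

section \<open>Comparison principle and asymptotics for the Caputo derivative\<close>

text \<open>The Abel lemmas ask for a bounded Borel function on the whole line. A function
  continuous on a compact interval qualifies once it is cut off outside.\<close>

lemma bounded_measurable_extension:
  fixes f :: "real \<Rightarrow> real"
  assumes "continuous_on {a..b} f"
  obtains B where "(\<lambda>r. indicator {a..b} r * f r) \<in> borel_measurable borel"
    "\<And>r. \<bar>indicator {a..b} r * f r\<bar> \<le> B"
proof -
  have "bounded (f ` {a..b})"
    using assms by (intro compact_imp_bounded compact_continuous_image) auto
  then obtain B where "\<forall>x\<in>{a..b}. \<bar>f x\<bar> \<le> B"
    unfolding bounded_iff by auto
  then have "\<bar>indicator {a..b} r * f r\<bar> \<le> \<bar>B\<bar>" for r
    by (force simp: indicator_def)
  moreover have "(\<lambda>r. indicator {a..b} r *\<^sub>R f r) \<in> borel_measurable borel"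
    using assms by (intro borel_measurable_continuous_on_indicator) auto
  ultimately show ?thesis using that[of "\<bar>B\<bar>"] by simp
qed

lemma powr_tendsto_0_at_right:
  fixes a :: real
  assumes "0 < a"
  shows "((\<lambda>s. s powr a) \<longlongrightarrow> 0) (at_right 0)"
proof (rule tendsto_zero_powrI)
  show "eventually (\<lambda>s::real. 0 \<le> s) (at_right 0)"
    by (rule eventually_mono[OF eventually_at_right_less]) simp
qed (use assms in \<open>auto intro: tendsto_intros\<close>)

lemma caputo_prim_integrable:
  fixes v :: "real \<Rightarrow> real"
  assumes "continuous_on {0..t} v" "0 \<le> t" "\<mu> < 1"
  shows "(\<lambda>s. (v s - v 0) / (t - s) powr \<mu>) integrable_on {0..t}"
proof -
  have "continuous_on {0..t} (\<lambda>s. v s - v 0)" using assms by (intro continuous_intros)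
  then obtain B where "(\<lambda>r. indicator {0..t} r * (v r - v 0)) \<in> borel_measurable borel"
      "\<And>r. \<bar>indicator {0..t} r * (v r - v 0)\<bar> \<le> B"
    using bounded_measurable_extension by blast
  from set_borel_integral_eq_integral(1)[OF abel_kernel_integrable(1)[OF this assms(3,2)]]
  show ?thesis by (rule integrable_eq) auto
qed

text \<open>If the Caputo primitive is nondecreasing, so is its convolution with \<open>s\<^sup>\<mu>\<^sup>-\<^sup>1\<close>, which by
  \<open>abel_fubini\<close> is a positive multiple of the integral of \<open>v - v 0\<close>.\<close>

lemma caputo_compare:
  assumes v: "continuous_on {0..\<tau>} v" and \<mu>: "0 < \<mu>" "\<mu> < 1"
    and deriv: "\<And>t. 0 < t \<Longrightarrow> t < \<tau> \<Longrightarrow> (caputo_prim \<mu> v has_real_derivative D t) (at t)"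
    and D: "\<And>t. 0 < t \<Longrightarrow> t < \<tau> \<Longrightarrow> 0 \<le> D t"
    and t: "0 \<le> t" "t < \<tau>"
  shows "v 0 \<le> v t"
proof -
  define f where "f = (\<lambda>r. indicator {0..\<tau>} r * (v r - v 0))"
  define P where "P = caputo_prim \<mu> v"
  define b where "b = Beta (1 - \<mu>) \<mu>"
  have b: "b > 0" using \<mu> by (simp add: b_def Beta_def Gamma_real_pos)
  have vc: "continuous_on {0..\<tau>} (\<lambda>r. v r - v 0)" using v by (intro continuous_intros)
  obtain B where f: "f \<in> borel_measurable borel" "\<And>r. \<bar>f r\<bar> \<le> B"
    using bounded_measurable_extension[OF vc] unfolding f_def by blast
  have P_eq: "P s = integral {0..s} (\<lambda>r. f r / (s - r) powr \<mu>)" if "s \<le> \<tau>" for s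
    unfolding P_def caputo_prim_def using that by (intro integral_cong) (auto simp: f_def)
  have P0: "(P \<longlongrightarrow> 0) (at_right 0)"
  proof (rule Lim_null_comparison)
    have "eventually (\<lambda>s. s \<in> {0<..<\<tau>}) (at_right 0)"
      using t by (intro eventually_at_right_real) auto
    then show "eventually (\<lambda>s. norm (P s) \<le> B * (s powr (1 - \<mu>) / (1 - \<mu>))) (at_right 0)"
      by eventually_elim (use abel_kernel_integrable(2)[OF f \<mu>(2)] P_eq in auto)
    have "((\<lambda>s. s powr (1 - \<mu>)) \<longlongrightarrow> 0) (at_right 0)"
      using \<mu> by (intro powr_tendsto_0_at_right) auto
    then show "((\<lambda>s. B * (s powr (1 - \<mu>) / (1 - \<mu>))) \<longlongrightarrow> 0) (at_right 0)"
      by (intro tendsto_mult_right_zero tendsto_divide_zero)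
  qed
  have P_mono: "P s \<le> P s'" if "0 < s" "s \<le> s'" "s' < \<tau>" for s s'
  proof (rule DERIV_nonneg_imp_nondecreasing[OF that(2)])
    fix x assume "s \<le> x" "x \<le> s'"
    then have "0 < x" "x < \<tau>" using that by auto
    then show "\<exists>y. (P has_real_derivative y) (at x) \<and> 0 \<le> y"
      unfolding P_def using deriv D by blast
  qed
  \<comment> \<open>A nondecreasing function with limit 0 at the left end is nonnegative; at 0
    itself the primitive is an integral over a point.\<close>
  have P_nonneg: "0 \<le> P s" if "0 \<le> s" "s < \<tau>" for s
  proof (cases "s = 0")
    case True then show ?thesis by (simp add: P_def caputo_prim_def)
  next
    case False
    then have "eventually (\<lambda>r. r \<in> {0<..<s}) (at_right 0)"
      using that by (intro eventually_at_right_real) auto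
    then have "eventually (\<lambda>r. P r \<le> P s) (at_right 0)"
      by eventually_elim (use that P_mono in auto)
    then show ?thesis by (rule tendsto_upperbound[OF P0]) simp
  qed
  have P_mono': "P s \<le> P s'" if "0 \<le> s" "s \<le> s'" "s' < \<tau>" for s s'
    using that P_mono P_nonneg[of s'] by (cases "s = 0") (auto simp: P_def caputo_prim_def)
  \<comment> \<open>Reflection moves the dependence on \<open>t\<close> from the singular kernel to
    the monotone factor \<open>P\<close>, so integrands for different \<open>t\<close> can be
    compared pointwise.\<close>
  have conv: "((\<lambda>s. s powr (\<mu> - 1) * P (t - s)) has_integral b * integral {0..t} f) {0..t}"
    if "t \<le> \<tau>" for t
  proof -
    have "((\<lambda>s. (t - s) powr (\<mu> - 1) * P s) has_integral b * integral {0..t} f) {0..t}"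
      unfolding b_def using abel_fubini[OF f \<mu>, of t] that
      by (subst has_integral_cong[OF arg_cong[where f = "\<lambda>x. _ * x", OF P_eq]]) auto
    from has_integral_reflect_Icc[OF this] show ?thesis by simp
  qed
  have mono: "mono_on {0..<\<tau>} (\<lambda>t. integral {0..t} f)"
  proof (rule mono_onI)
    fix t1 t2 assume t12: "t1 \<in> {0..<\<tau>}" "t2 \<in> {0..<\<tau>}" "t1 \<le> t2"
    \<comment> \<open>The integrand for \<open>t1\<close> is extended by zero to
      \<open>{0..t2}\<close>. It stays below the one for \<open>t2\<close>, by monotonicity of
      \<open>P\<close> on \<open>{0..t1}\<close> and by its nonnegativity beyond.\<close>
    have "((\<lambda>s. if s \<in> {0..t1} then s powr (\<mu> - 1) * P (t1 - s) else 0)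
        has_integral b * integral {0..t1} f) {0..t2}"
      using conv[of t1] t12 by (subst has_integral_restrict) auto
    moreover have "((\<lambda>s. s powr (\<mu> - 1) * P (t2 - s)) has_integral b * integral {0..t2} f) {0..t2}"
      using conv[of t2] t12 by auto
    ultimately have "b * integral {0..t1} f \<le> b * integral {0..t2} f"
      by (rule has_integral_le) (use t12 P_mono' P_nonneg in \<open>auto intro!: mult_left_mono\<close>)
    then show "integral {0..t1} f \<le> integral {0..t2} f" using b by simp
  qed
  show ?thesis
  proof (cases "t = 0")
    case False
    \<comment> \<open>At an interior time the derivative of this nondecreasing integral is
      \<open>v t - v 0\<close>, which is therefore nonnegative.\<close>
    have eq: "integral {0..s} f = integral {0..s} (\<lambda>r. v r - v 0)" if "s < \<tau>" for s
      using that by (intro integral_cong) (auto simp: f_def)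
    have "((\<lambda>s. integral {0..s} (\<lambda>r. v r - v 0)) has_real_derivative v t - v 0) (at t within {0..\<tau>})"
      using t by (intro integral_has_real_derivative vc) auto
    then have "((\<lambda>s. integral {0..s} (\<lambda>r. v r - v 0)) has_real_derivative v t - v 0) (at t)"
      using t False by (simp add: at_within_Icc_at)
    moreover have "mono_on {0..<\<tau>} (\<lambda>s. integral {0..s} (\<lambda>r. v r - v 0))"
      using mono by (simp add: mono_on_def eq)
    ultimately have "0 \<le> v t - v 0"
      using t False by (intro mono_on_imp_deriv_nonneg) auto
    then show ?thesis by simp
  qed simp
qed

section \<open>Comparison with multiples of a power of t\<close>

lemma Beta_one_plus_one_minus:
  fixes \<mu> :: real
  shows "Beta (1 + \<mu>) (1 - \<mu>) = Gamma (1 - \<mu>) * Gamma (1 + \<mu>)"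
  using Gamma_fact[of 1, where 'a = real] by (simp add: Beta_def mult.commute)

text \<open>The Caputo primitive of \<open>A * s powr \<mu>\<close> is linear in \<open>t\<close>,
  so its Caputo derivative of order \<open>\<mu>\<close> is the constant
  \<open>A * Gamma (1 + \<mu>)\<close>. This makes the power the natural comparison
  function.\<close>

lemma has_integral_caputo_powr:
  fixes A \<mu> t :: real
  assumes "0 < \<mu>" "\<mu> < 1" "0 \<le> t"
  shows "((\<lambda>s. (A * s powr \<mu>) / (t - s) powr \<mu>) has_integral
          A * (Gamma (1 - \<mu>) * Gamma (1 + \<mu>) * t)) {0..t}"
proof (cases "t = 0")
  case False
  then have "((\<lambda>s. (t - s) powr (1 - \<mu> - 1) * (s - 0) powr (1 + \<mu> - 1)) has_integral
      Beta (1 + \<mu>) (1 - \<mu>) * (t - 0) powr (1 - \<mu> + (1 + \<mu>) - 1)) {0..t}"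
    using assms by (intro has_integral_Beta_Icc) auto
  from has_integral_mult_right[OF this, of A] show ?thesis
    using assms by (simp add: Beta_one_plus_one_minus powr_minus_divide mult_ac)
qed auto

text \<open>Subtracting the multiple of \<open>t powr \<mu>\<close> whose Caputo derivative equals
  \<open>c\<close> leaves a function with nonnegative Caputo derivative, to which
  \<open>caputo_compare\<close> applies.\<close>

lemma caputo_lower_bound:
  assumes v: "continuous_on {0..\<tau>} v" and \<mu>: "0 < \<mu>" "\<mu> < 1"
    and deriv: "\<And>t. 0 < t \<Longrightarrow> t < \<tau> \<Longrightarrow> (caputo_prim \<mu> v has_real_derivative Gamma (1 - \<mu>) * w t) (at t)"
    and w: "\<And>t. 0 < t \<Longrightarrow> t < \<tau> \<Longrightarrow> c \<le> w t"
    and t: "0 \<le> t" "t < \<tau>"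
  shows "c * (t powr \<mu> / Gamma (1 + \<mu>)) \<le> v t - v 0"
proof -
  define A where "A = c / Gamma (1 + \<mu>)"
  define V where "V = (\<lambda>s. v s - A * s powr \<mu>)"
  have G: "Gamma (1 + \<mu>) > 0" "Gamma (1 - \<mu>) > 0" using \<mu> by (auto intro: Gamma_real_pos)
  have "V 0 \<le> V t"
  proof (rule caputo_compare[OF _ \<mu> _ _ t])
    show "continuous_on {0..\<tau>} V"
      unfolding V_def using v \<mu> by (intro continuous_intros continuous_on_powr') auto
    fix s assume s: "0 < s" "s < \<tau>"
    \<comment> \<open>The subtracted power changes the primitive by a linear term, hence its
      derivative by a constant.\<close>
    have eq: "caputo_prim \<mu> V r = caputo_prim \<mu> v r - Gamma (1 - \<mu>) * c * r"
      if "r \<in> {0<..<\<tau>}" for r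
    proof -
      have "((\<lambda>s. (v s - v 0) / (r - s) powr \<mu>) has_integral caputo_prim \<mu> v r) {0..r}"
        unfolding caputo_prim_def using that \<mu>
        by (intro integrable_integral caputo_prim_integrable continuous_on_subset[OF v]) auto
      moreover have "((\<lambda>s. (A * s powr \<mu>) / (r - s) powr \<mu>) has_integral
          A * (Gamma (1 - \<mu>) * Gamma (1 + \<mu>) * r)) {0..r}"
        using that \<mu> by (intro has_integral_caputo_powr) auto
      ultimately have "((\<lambda>s. (v s - v 0) / (r - s) powr \<mu> - (A * s powr \<mu>) / (r - s) powr \<mu>) has_integral
          caputo_prim \<mu> v r - A * (Gamma (1 - \<mu>) * Gamma (1 + \<mu>) * r)) {0..r}"
        by (rule has_integral_diff)
      moreover have "(\<lambda>s. (v s - v 0) / (r - s) powr \<mu> - (A * s powr \<mu>) / (r - s) powr \<mu>) =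
          (\<lambda>s. (V s - V 0) / (r - s) powr \<mu>)"
        using \<mu> by (simp add: V_def fun_eq_iff diff_divide_distrib)
      moreover have "A * (Gamma (1 - \<mu>) * Gamma (1 + \<mu>) * r) = Gamma (1 - \<mu>) * c * r"
        using G by (simp add: A_def)
      ultimately show ?thesis
        unfolding caputo_prim_def[of \<mu> V] by (simp add: integral_unique)
    qed
    have "((\<lambda>r. caputo_prim \<mu> v r - Gamma (1 - \<mu>) * c * r) has_real_derivative
        Gamma (1 - \<mu>) * w s - Gamma (1 - \<mu>) * c) (at s)"
      using deriv[OF s] by (auto intro!: derivative_eq_intros)
    then show "(caputo_prim \<mu> V has_real_derivative Gamma (1 - \<mu>) * (w s - c)) (at s)"
      unfolding right_diff_distrib
      by (rule has_field_derivative_transform_within_open[where S = "{0<..<\<tau>}"]) (use s eq in auto)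
    show "0 \<le> Gamma (1 - \<mu>) * (w s - c)" using w[OF s] G by simp
  qed
  then show ?thesis using \<mu> by (simp add: V_def A_def)
qed

lemma caputo_on_has_derivative:
  assumes "caputo_on \<tau> \<mu> v w" "\<mu> < 1" "0 < t" "t < \<tau>"
  shows "(caputo_prim \<mu> v has_real_derivative Gamma (1 - \<mu>) * w t) (at t)"
proof -
  have "Gamma (1 - \<mu>) > 0" using assms by (auto intro: Gamma_real_pos)
  moreover have "caputo_prim \<mu> v field_differentiable at t" "caputo \<mu> v t = w t"
    using assms by (auto simp: caputo_on_def)
  ultimately show ?thesis
    using field_differentiable_derivI[of "caputo_prim \<mu> v" t] by (simp add: caputo_def field_simps)
qed

text \<open>The lower bound is applied to \<open>v\<close> with \<open>c - e\<close> and to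
  \<open>- v\<close> with \<open>- c - e\<close>. The error depends on the function only through the
  oscillation \<open>e\<close> of its Caputo derivative, which is the source of uniformity in
  \<open>x\<close>.\<close>

lemma caputo_on_bound:
  assumes v: "continuous_on {0..\<tau>} v" and \<mu>: "0 < \<mu>" "\<mu> < 1"
    and cap: "caputo_on \<tau> \<mu> v w" and \<delta>: "\<delta> \<le> \<tau>"
    and w: "\<And>t. 0 < t \<Longrightarrow> t < \<delta> \<Longrightarrow> \<bar>w t - c\<bar> \<le> e"
    and t: "0 < t" "t < \<delta>"
  shows "\<bar>(v t - v 0) / t powr \<mu> - c / Gamma (1 + \<mu>)\<bar> \<le> e / Gamma (1 + \<mu>)"
proof -
  have G: "Gamma (1 + \<mu>) > 0" using \<mu> by (auto intro: Gamma_real_pos)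
  have tp: "t powr \<mu> > 0" using t by simp
  have deriv: "(caputo_prim \<mu> v has_real_derivative Gamma (1 - \<mu>) * w s) (at s)"
    if "0 < s" "s < \<delta>" for s using caputo_on_has_derivative[OF cap \<mu>(2)] that \<delta> by auto
  have vc: "continuous_on {0..\<delta>} v" using v \<delta> by (auto intro: continuous_on_subset)
  have low: "c - e \<le> w s" if "0 < s" "s < \<delta>" for s using w[OF that] by linarith
  have 1: "(c - e) * (t powr \<mu> / Gamma (1 + \<mu>)) \<le> v t - v 0"
    by (rule caputo_lower_bound[OF vc \<mu> deriv low]) (use t in auto)
  have 2: "(- c - e) * (t powr \<mu> / Gamma (1 + \<mu>)) \<le> (\<lambda>s. - v s) t - (\<lambda>s. - v s) 0"
  proof (rule caputo_lower_bound[OF _ \<mu>])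
    show "continuous_on {0..\<delta>} (\<lambda>s. - v s)" using vc by (intro continuous_intros)
    have neg: "caputo_prim \<mu> (\<lambda>s. - v s) = (\<lambda>s. - caputo_prim \<mu> v s)"
    proof
      fix s
      have "(\<lambda>r. (- v r - - v 0) / (s - r) powr \<mu>) = (\<lambda>r. - ((v r - v 0) / (s - r) powr \<mu>))"
        by (simp add: fun_eq_iff diff_divide_distrib)
      then show "caputo_prim \<mu> (\<lambda>s. - v s) s = - caputo_prim \<mu> v s"
        by (simp add: caputo_prim_def)
    qed
    show "(caputo_prim \<mu> (\<lambda>s. - v s) has_real_derivative Gamma (1 - \<mu>) * (- w s)) (at s)"
      if "0 < s" "s < \<delta>" for s
      unfolding neg using DERIV_minus[OF deriv[OF that]] by simp
    show "- c - e \<le> - w s" if "0 < s" "s < \<delta>" for s using w[OF that] by linarith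
  qed (use t in auto)
  have "(c - e) / Gamma (1 + \<mu>) \<le> (v t - v 0) / t powr \<mu>"
    using divide_right_mono[OF 1, of "t powr \<mu>"] tp by simp
  moreover have "(- c - e) / Gamma (1 + \<mu>) \<le> - ((v t - v 0) / t powr \<mu>)"
  proof -
    have "(- c - e) * (t powr \<mu> / Gamma (1 + \<mu>)) / t powr \<mu> \<le> (- v t - - v 0) / t powr \<mu>"
      using 2 by (rule divide_right_mono) (use tp in simp)
    moreover have "(- v t - - v 0) / t powr \<mu> = - ((v t - v 0) / t powr \<mu>)"
      by (simp add: diff_divide_distrib)
    ultimately show ?thesis using tp by simp
  qed
  ultimately show ?thesis
    unfolding abs_le_iff diff_divide_distrib minus_divide_left[symmetric] by linarith
qed

text \<open>Uniform continuity of \<open>W\<close> on the compact product bounds its oscillation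
  near time 0 by one \<open>e'\<close> for all points of \<open>K\<close>.\<close>

lemma caputo_uniform_limit:
  fixes v W :: "'a::metric_space \<Rightarrow> real \<Rightarrow> real"
  assumes v: "\<And>x. x \<in> K \<Longrightarrow> continuous_on {0..\<tau>} (v x)" and \<mu>: "0 < \<mu>" "\<mu> < 1"
    and cap: "\<And>x. x \<in> K \<Longrightarrow> caputo_on \<tau> \<mu> (v x) (W x)"
    and K: "compact K" and W: "continuous_on (K \<times> {0..\<tau>}) (\<lambda>(x, t). W x t)" and \<tau>: "0 < \<tau>"
  shows "uniform_limit K (\<lambda>t x. (v x t - v x 0) / t powr \<mu>) (\<lambda>x. W x 0 / Gamma (1 + \<mu>)) (at_right 0)"
proof (rule uniform_limitI)
  fix e :: real assume e: "0 < e"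
  have G: "Gamma (1 + \<mu>) > 0" using \<mu> by (auto intro: Gamma_real_pos)
  \<comment> \<open>With this choice the error \<open>e' / Gamma (1 + \<mu>)\<close> is
    \<open>e / 2\<close>, strictly below \<open>e\<close>.\<close>
  define e' where "e' = e * Gamma (1 + \<mu>) / 2"
  have e': "e' > 0" using e G by (simp add: e'_def)
  have "uniformly_continuous_on (K \<times> {0..\<tau>}) (\<lambda>(x, t). W x t)"
    using W K by (intro compact_uniformly_continuous compact_Times) auto
  then obtain d where d: "d > 0" "\<And>p q. p \<in> K \<times> {0..\<tau>} \<Longrightarrow> q \<in> K \<times> {0..\<tau>} \<Longrightarrow> dist q p < d \<Longrightarrow>
      dist ((\<lambda>(x, t). W x t) q) ((\<lambda>(x, t). W x t) p) < e'"
    unfolding uniformly_continuous_on_def using e' by meson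
  have W': "\<bar>W x t - W x 0\<bar> \<le> e'" if "x \<in> K" "0 < t" "t < min d \<tau>" for x t
    using d(2)[of "(x, 0)" "(x, t)"] that by (auto simp: dist_Pair_Pair dist_real_def)
  have "eventually (\<lambda>t. t \<in> {0<..<min d \<tau>}) (at_right 0)"
    using d \<tau> by (intro eventually_at_right_real) auto
  then show "\<forall>\<^sub>F t in at_right 0. \<forall>x\<in>K. dist ((v x t - v x 0) / t powr \<mu>) (W x 0 / Gamma (1 + \<mu>)) < e"
  proof eventually_elim
    case (elim t)
    show ?case
    proof
      fix x assume x: "x \<in> K"
      have "\<bar>(v x t - v x 0) / t powr \<mu> - W x 0 / Gamma (1 + \<mu>)\<bar> \<le> e' / Gamma (1 + \<mu>)"
        by (rule caputo_on_bound[OF v[OF x] \<mu> cap[OF x] min.cobounded2 W'[OF x]]) (use elim in auto)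
      also have "\<dots> < e" using G e by (simp add: e'_def)
      finally show "dist ((v x t - v x 0) / t powr \<mu>) (W x 0 / Gamma (1 + \<mu>)) < e"
        by (simp add: dist_real_def)
    qed
  qed
qed

lemma caputo_limit:
  assumes "continuous_on {0..\<tau>} v" "0 < \<mu>" "\<mu> < 1" "caputo_on \<tau> \<mu> v w" "0 < \<tau>"
  shows "((\<lambda>t. (v t - v 0) / t powr \<mu>) \<longlongrightarrow> w 0 / Gamma (1 + \<mu>)) (at_right 0)"
proof -
  have "continuous_on {0..\<tau>} w" using assms by (simp add: caputo_on_def)
  \<comment> \<open>A single function is treated as a family over a one-point compact set, so the
    uniform statement yields the scalar one.\<close>
  then have "continuous_on ({0::real} \<times> {0..\<tau>}) (\<lambda>p. w (snd p))"
    by (rule continuous_on_compose2) (auto intro: continuous_on_snd continuous_on_id)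
  then have W: "continuous_on ({0::real} \<times> {0..\<tau>}) (\<lambda>(x, t). w t)"
    by (simp add: case_prod_beta)
  have "uniform_limit {0::real} (\<lambda>t x. (v t - v 0) / t powr \<mu>) (\<lambda>x. w 0 / Gamma (1 + \<mu>)) (at_right 0)"
    by (rule caputo_uniform_limit[OF assms(1,2,3,4) _ W assms(5)]) simp
  from tendsto_uniform_limitI[OF this] show ?thesis by simp
qed

text \<open>If \<open>f\<close> behaves like \<open>A * t powr \<mu>\<close>, its integral behaves
  like \<open>A / (1 + \<mu>) * t powr (1 + \<mu>)\<close> by l'Hopital's rule. In the quotient the
  unknown \<open>A\<close> cancels and \<open>1 + \<mu>\<close> remains.\<close>

lemma powr_asymptotics_ratio:
  fixes f :: "real \<Rightarrow> real"
  assumes f: "continuous_on {0..\<tau>} f" and \<tau>: "0 < \<tau>" and \<mu>: "0 < \<mu>"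
    and lim: "((\<lambda>t. f t / t powr \<mu>) \<longlongrightarrow> A) (at_right 0)" and A: "A \<noteq> 0"
  shows "((\<lambda>t. t * f t / integral {0..t} f - 1) \<longlongrightarrow> \<mu>) (at_right 0)"
proof -
  let ?F = "\<lambda>t. integral {0..t} f"
  have ev: "eventually (\<lambda>t. t \<in> {0<..<\<tau>}) (at_right 0)"
    using \<tau> by (intro eventually_at_right_real) auto
  have F: "(?F has_real_derivative f t) (at t within {0..\<tau>})" if "t \<in> {0..\<tau>}" for t
    using that f by (intro integral_has_real_derivative)
  have "(?F \<longlongrightarrow> ?F 0) (at_right 0)"
    using DERIV_continuous[OF F[of 0]] \<tau> by (simp add: continuous_within at_within_Icc_at_right)
  then have F0: "(?F \<longlongrightarrow> 0) (at_right 0)" by simp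
  have limF: "((\<lambda>t. ?F t / t powr (1 + \<mu>)) \<longlongrightarrow> A / (1 + \<mu>)) (at_right 0)"
  proof (rule lhopital_right_0[OF F0])
    show "((\<lambda>t::real. t powr (1 + \<mu>)) \<longlongrightarrow> 0) (at_right 0)"
      using \<mu> by (intro powr_tendsto_0_at_right) auto
    show "eventually (\<lambda>t. t powr (1 + \<mu>) \<noteq> 0) (at_right 0)"
      using ev by eventually_elim auto
    show "eventually (\<lambda>t. (1 + \<mu>) * t powr \<mu> \<noteq> 0) (at_right 0)"
      using ev by eventually_elim (use \<mu> in auto)
    show "eventually (\<lambda>t. (?F has_real_derivative f t) (at t)) (at_right 0)"
      using ev
    proof eventually_elim
      case (elim t)
      then show ?case using F[of t] by (simp add: at_within_Icc_at)
    qed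
    show "eventually (\<lambda>t. ((\<lambda>t. t powr (1 + \<mu>)) has_real_derivative (1 + \<mu>) * t powr \<mu>) (at t)) (at_right 0)"
      using ev
    proof eventually_elim
      case (elim t)
      then show ?case using has_real_derivative_powr[of t "1 + \<mu>"] by simp
    qed
    have "((\<lambda>t. (f t / t powr \<mu>) / (1 + \<mu>)) \<longlongrightarrow> A / (1 + \<mu>)) (at_right 0)"
      by (intro tendsto_divide tendsto_const lim) (use \<mu> in auto)
    then show "((\<lambda>t. f t / ((1 + \<mu>) * t powr \<mu>)) \<longlongrightarrow> A / (1 + \<mu>)) (at_right 0)"
      by (simp add: divide_divide_eq_left mult.commute)
  qed
  have lim2: "((\<lambda>t. (f t / t powr \<mu>) / (?F t / t powr (1 + \<mu>)) - 1) \<longlongrightarrow> A / (A / (1 + \<mu>)) - 1) (at_right 0)"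
    by (intro tendsto_diff tendsto_divide tendsto_const lim limF) (use A \<mu> in auto)
  have val: "A / (A / (1 + \<mu>)) - 1 = \<mu>" using A by simp
  have "eventually (\<lambda>t. (f t / t powr \<mu>) / (?F t / t powr (1 + \<mu>)) - 1 = t * f t / ?F t - 1) (at_right 0)"
    using ev
  proof eventually_elim
    case (elim t)
    then have split: "t powr (1 + \<mu>) = t * t powr \<mu>" and nz: "t powr \<mu> \<noteq> 0"
      by (simp_all add: powr_add)
    have "(a / p) / (b / (t * p)) = t * a / b" if "p \<noteq> 0" for a b p :: real
      using that by simp
    from this[OF nz] show ?case unfolding split by simp
  qed
  from Lim_transform_eventually[OF lim2[unfolded val] this] show ?thesis .
qed

section \<open>Limits at the initial time\<close>

lemma increment_limit_smaller_power:
  fixes \<mu> \<nu> :: real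
  assumes "((\<lambda>t. f t / t powr \<nu>) \<longlongrightarrow> L) (at_right 0)" "\<mu> < \<nu>"
  shows "((\<lambda>t. f t / t powr \<mu>) \<longlongrightarrow> 0) (at_right 0)"
proof -
  have "((\<lambda>t. f t / t powr \<nu> * t powr (\<nu> - \<mu>)) \<longlongrightarrow> L * 0) (at_right 0)"
    by (intro tendsto_mult assms powr_tendsto_0_at_right) (use assms in simp)
  then have lim: "((\<lambda>t. f t / t powr \<nu> * t powr (\<nu> - \<mu>)) \<longlongrightarrow> 0) (at_right 0)" by simp
  have "eventually (\<lambda>t. f t / t powr \<nu> * t powr (\<nu> - \<mu>) = f t / t powr \<mu>) (at_right 0)"
    using eventually_at_right_less[of 0]
  proof eventually_elim
    case (elim t)
    then have "t powr \<nu> \<noteq> 0" by simp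
    then show ?case by (simp add: powr_diff)
  qed
  from Lim_transform_eventually[OF lim this] show ?thesis .
qed

text \<open>A one-sided derivative is an increment limit for the exponent 1, and smaller exponents
  then give 0. It serves the coefficients of the type II operator, which are differentiable in
  time.\<close>

lemma derivative_increment_limit:
  fixes p :: "real \<Rightarrow> real"
  assumes "(p has_real_derivative p') (at 0 within {0..T})" "0 < T" "\<mu> < 1"
  shows "((\<lambda>t. (p t - p 0) / t powr \<mu>) \<longlongrightarrow> 0) (at_right 0)"
proof -
  have lim: "((\<lambda>t. (p t - p 0) / t) \<longlongrightarrow> p') (at_right 0)"
    using assms by (simp add: has_field_derivative_iff at_within_Icc_at_right)
  have "eventually (\<lambda>t. (p t - p 0) / t = (p t - p 0) / t powr 1) (at_right 0)"
    using eventually_at_right_less[of 0] by eventually_elim simp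
  from Lim_transform_eventually[OF lim this] show ?thesis
    by (rule increment_limit_smaller_power) fact
qed

text \<open>In the type II operator the leading term controls the increments of
  \<open>r_coef P 0 x t * u x t\<close>, whereas a lower term involves another weight. Dividing out
  the weight \<open>p\<close>, nonzero near 0, recovers the increments of \<open>u\<close>, and the
  weight \<open>q\<close> is then put back.\<close>

lemma weighted_increment_limit:
  fixes p q u :: "real \<Rightarrow> real"
  assumes lim: "((\<lambda>t. (p t * u t - p 0 * u 0) / t powr \<mu>) \<longlongrightarrow> 0) (at_right 0)"
    and p: "((\<lambda>t. (p t - p 0) / t powr \<mu>) \<longlongrightarrow> 0) (at_right 0)" "(p \<longlongrightarrow> p 0) (at_right 0)" "p 0 \<noteq> 0"
    and q: "((\<lambda>t. (q t - q 0) / t powr \<mu>) \<longlongrightarrow> 0) (at_right 0)" "(q \<longlongrightarrow> q 0) (at_right 0)"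
  shows "((\<lambda>t. (q t * u t - q 0 * u 0) / t powr \<mu>) \<longlongrightarrow> 0) (at_right 0)"
proof -
  have "((\<lambda>t. ((p t * u t - p 0 * u 0) / t powr \<mu> - u 0 * ((p t - p 0) / t powr \<mu>)) / p t)
      \<longlongrightarrow> (0 - u 0 * 0) / p 0) (at_right 0)"
    by (intro tendsto_divide tendsto_diff tendsto_mult tendsto_const lim p)
  then have lim_u: "((\<lambda>t. ((p t * u t - p 0 * u 0) / t powr \<mu> - u 0 * ((p t - p 0) / t powr \<mu>)) / p t)
      \<longlongrightarrow> 0) (at_right 0)" by simp
  have "eventually (\<lambda>t. p t \<noteq> 0) (at_right 0)"
    using p by (intro tendsto_imp_eventually_ne)
  then have "eventually (\<lambda>t. ((p t * u t - p 0 * u 0) / t powr \<mu> - u 0 * ((p t - p 0) / t powr \<mu>)) / p t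
      = (u t - u 0) / t powr \<mu>) (at_right 0)"
  proof eventually_elim
    case (elim t)
    have "(p t * u t - p 0 * u 0) / t powr \<mu> - u 0 * ((p t - p 0) / t powr \<mu>) =
        (p t * u t - p 0 * u 0 - u 0 * (p t - p 0)) / t powr \<mu>"
      by (simp add: diff_divide_distrib right_diff_distrib)
    \<comment> \<open>This is the discrete product rule, solved for the increment of
      \<open>u\<close>.\<close>
    also have "p t * u t - p 0 * u 0 - u 0 * (p t - p 0) = p t * (u t - u 0)"
      by (simp add: algebra_simps)
    finally show ?case using elim by simp
  qed
  from Lim_transform_eventually[OF lim_u this]
  have u: "((\<lambda>t. (u t - u 0) / t powr \<mu>) \<longlongrightarrow> 0) (at_right 0)" .
  have "((\<lambda>t. q t * ((u t - u 0) / t powr \<mu>) + u 0 * ((q t - q 0) / t powr \<mu>)) \<longlongrightarrow> q 0 * 0 + u 0 * 0) (at_right 0)"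
    by (intro tendsto_add tendsto_mult tendsto_const u q)
  moreover have "(\<lambda>t. q t * ((u t - u 0) / t powr \<mu>) + u 0 * ((q t - q 0) / t powr \<mu>)) =
      (\<lambda>t. (q t * u t - q 0 * u 0) / t powr \<mu>)"
    by (simp add: fun_eq_iff algebra_simps diff_divide_distrib)
  ultimately show ?thesis by simp
qed

text \<open>Since \<open>h\<close> is bounded, the convolution is at most a constant times the
  integral of the absolute value of \<open>K\<close> over \<open>{0..t}\<close>, which tends to 0 by
  continuity of the indefinite integral.\<close>

lemma tconv_tendsto_0:
  assumes K: "K absolutely_integrable_on {0<..<T}" and h: "continuous_on {0..\<tau>} h" and \<tau>: "0 < \<tau>" "\<tau> < T"
  shows "(tconv K h \<longlongrightarrow> 0) (at_right 0)"
proof -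
  have "bounded (h ` {0..\<tau>})"
    using h by (intro compact_imp_bounded compact_continuous_image) auto
  then obtain B where B: "\<forall>x\<in>{0..\<tau>}. \<bar>h x\<bar> \<le> B" unfolding bounded_iff by auto
  have Kabs: "(\<lambda>s. \<bar>K s\<bar>) integrable_on {0..T}"
    using K by (simp add: absolutely_integrable_on_def integrable_on_Icc_iff_Ioo)
  have "eventually (\<lambda>t. t \<in> {0<..<\<tau>}) (at_right 0)"
    using \<tau> by (intro eventually_at_right_real) auto
  then have bound: "eventually (\<lambda>t. norm (tconv K h t) \<le> B * integral {0..t} (\<lambda>s. \<bar>K s\<bar>)) (at_right 0)"
  proof eventually_elim
    case (elim t)
    have "(\<lambda>s. \<bar>K s\<bar>) integrable_on {0..t}"
      by (rule integrable_on_subinterval[OF Kabs]) (use elim \<tau> in auto)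
    from has_integral_mult_right[OF has_integral_reflect_Icc[OF integrable_integral[OF this]], of B]
    have int: "((\<lambda>s. B * \<bar>K (t - s)\<bar>) has_integral B * integral {0..t} (\<lambda>s. \<bar>K s\<bar>)) {0..t}" .
    have bd: "norm (K (t - s) * h s) \<le> B * \<bar>K (t - s)\<bar>" if "s \<in> {0..t}" for s
    proof -
      have "\<bar>h s\<bar> \<le> B" using B that elim by auto
      then have "\<bar>K (t - s)\<bar> * \<bar>h s\<bar> \<le> \<bar>K (t - s)\<bar> * B" by (intro mult_left_mono) auto
      then show ?thesis by (simp add: abs_mult mult.commute)
    qed
    show ?case
    proof (cases "(\<lambda>s. K (t - s) * h s) integrable_on {0..t}")
      case True
      then have "norm (tconv K h t) \<le> integral {0..t} (\<lambda>s. B * \<bar>K (t - s)\<bar>)"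
        unfolding tconv_def using int bd by (intro integral_norm_bound_integral) (auto simp: has_integral_integrable)
      then show ?thesis unfolding integral_unique[OF int] .
    next
      \<comment> \<open>A non-integrable integrand has integral 0 by convention, so the bound
        persists.\<close>
      case False
      then have "tconv K h t = 0" by (simp add: tconv_def not_integrable_integral)
      moreover have "0 \<le> B * integral {0..t} (\<lambda>s. \<bar>K s\<bar>)"
        by (rule has_integral_nonneg[OF int]) (use bd norm_ge_zero order_trans in blast)
      ultimately show ?thesis by simp
    qed
  qed
  have "continuous_on {0..T} (\<lambda>t. integral {0..t} (\<lambda>s. \<bar>K s\<bar>))"
    by (rule indefinite_integral_continuous_1[OF Kabs])
  from continuous_on_Icc_at_rightD[OF this] \<tau>
  have "((\<lambda>t. integral {0..t} (\<lambda>s. \<bar>K s\<bar>)) \<longlongrightarrow> 0) (at_right 0)" by simp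
  then have "((\<lambda>t. B * integral {0..t} (\<lambda>s. \<bar>K s\<bar>)) \<longlongrightarrow> 0) (at_right 0)"
    by (rule tendsto_mult_right_zero)
  with bound show ?thesis by (rule Lim_null_comparison)
qed

section \<open>Integration over the domain\<close>

lemma integrable_on_open_bounded:
  fixes f :: "'a::euclidean_space \<Rightarrow> real"
  assumes f: "continuous_on (closure \<Omega>) f" and "open \<Omega>" "bounded \<Omega>"
  shows "f integrable_on \<Omega>"
proof -
  have "bounded (f ` closure \<Omega>)"
    using assms by (intro compact_imp_bounded compact_continuous_image) (auto simp: compact_closure)
  then obtain B where B: "\<forall>x\<in>closure \<Omega>. \<bar>f x\<bar> \<le> B" unfolding bounded_iff by auto
  have sets: "\<Omega> \<in> sets lebesgue" using assms by auto
  show ?thesis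
  proof (rule measurable_bounded_by_integrable_imp_integrable[OF _ _ _ sets])
    show "f \<in> borel_measurable (lebesgue_on \<Omega>)"
      by (intro continuous_imp_measurable_on_sets_lebesgue sets continuous_on_subset[OF f] closure_subset)
    show "(\<lambda>x. B) integrable_on \<Omega>"
      using assms by (intro integrable_on_const lmeasurable_open)
    show "norm (f x) \<le> B" if "x \<in> \<Omega>" for x using B that closure_subset by fastforce
  qed
qed

lemma uniform_limit_integral_on:
  fixes f :: "'b \<Rightarrow> 'a::euclidean_space \<Rightarrow> real"
  assumes lim: "uniform_limit S f l F" and S: "S \<in> lmeasurable"
    and f: "eventually (\<lambda>t. f t integrable_on S) F" and l: "l integrable_on S"
  shows "((\<lambda>t. integral S (f t)) \<longlongrightarrow> integral S l) F"
proof (rule tendstoI)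
  fix e :: real assume e: "0 < e"
  \<comment> \<open>The added 1 avoids division by zero on null sets and makes the final estimate
    strict.\<close>
  define d where "d = e / (measure lebesgue S + 1)"
  have m: "measure lebesgue S \<ge> 0" by simp
  have d: "d > 0" "d * measure lebesgue S < e"
    using e m by (simp_all add: d_def field_simps add_pos_nonneg)
  have "eventually (\<lambda>t. \<forall>x\<in>S. dist (f t x) (l x) < d) F"
    using lim d by (simp add: uniform_limit_iff)
  then show "eventually (\<lambda>t. dist (integral S (f t)) (integral S l) < e) F"
    using f
  proof eventually_elim
    case (elim t)
    have "norm (integral S (\<lambda>x. f t x - l x)) \<le> integral S (\<lambda>x. d)"
      using elim l S
      by (intro integral_norm_bound_integral integrable_diff integrable_on_const)
        (auto simp: dist_real_def intro: less_imp_le)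
    also have "integral S (\<lambda>x. d) = d * measure lebesgue S"
      using lmeasure_integral[OF S] integral_mult_right[of S d "\<lambda>x. 1"] by simp
    finally show ?case
      using d elim l by (simp add: dist_real_def integral_diff)
  qed
qed

section \<open>Second-order operators up to the boundary\<close>

lemma partial_deriv_cong_open:
  assumes "open S" "x \<in> S" "\<And>y. y \<in> S \<Longrightarrow> f y = g y"
  shows "partial_deriv i f x = partial_deriv i g x"
proof -
  have "(f has_derivative D) (at x) \<longleftrightarrow> (g has_derivative D) (at x)" for D
    using assms has_derivative_transform_within_open[of f D x UNIV S g]
      has_derivative_transform_within_open[of g D x UNIV S f] by auto
  then show ?thesis by (simp add: partial_deriv_def frechet_derivative_def)
qed

text \<open>A point of the closure outside the set is a limit point of it, so the limit defining
  \<open>up_to_bdry\<close> is unique and equals the value of any continuous extension.\<close>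

lemma up_to_bdry_eq:
  fixes F :: "'a::metric_space \<Rightarrow> real"
  assumes F: "continuous_on (closure \<Omega>) F" and eq: "\<And>x. x \<in> \<Omega> \<Longrightarrow> F x = f x" and x: "x \<in> closure \<Omega>"
  shows "up_to_bdry \<Omega> f x = F x"
proof (cases "x \<in> \<Omega>")
  case False
  then have "x islimpt \<Omega>" using x by (auto simp: closure_def)
  then have nt: "at x within \<Omega> \<noteq> bot" by (simp add: trivial_limit_within)
  have "(F \<longlongrightarrow> F x) (at x within closure \<Omega>)" using F x by (simp add: continuous_on_def)
  then have "(F \<longlongrightarrow> F x) (at x within \<Omega>)" by (rule tendsto_within_subset) (rule closure_subset)
  moreover have "eventually (\<lambda>y. F y = f y) (at x within \<Omega>)"
    using eq by (simp add: eventually_at_filter)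
  ultimately have "(f \<longlongrightarrow> F x) (at x within \<Omega>)" by (rule Lim_transform_eventually)
  then show ?thesis using False nt by (simp add: up_to_bdry_def tendsto_Lim)
qed (use eq in \<open>simp add: up_to_bdry_def\<close>)

lemma continuous_on_slices:
  assumes "continuous_on (A \<times> B) (\<lambda>(x, t). F x t)"
  shows "t \<in> B \<Longrightarrow> continuous_on A (\<lambda>x. F x t)" "x \<in> A \<Longrightarrow> continuous_on B (F x)"
proof -
  assume "t \<in> B"
  then have "continuous_on A (\<lambda>x. (\<lambda>(x, t). F x t) (x, t))"
    by (intro continuous_on_compose2[OF assms] continuous_intros) auto
  then show "continuous_on A (\<lambda>x. F x t)" by simp
next
  assume "x \<in> A"
  then have "continuous_on B (\<lambda>t. (\<lambda>(x, t). F x t) (x, t))"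
    by (intro continuous_on_compose2[OF assms] continuous_intros) auto
  then show "continuous_on B (F x)" by simp
qed

lemma cont_ext_continuous:
  fixes f :: "'a::metric_space \<Rightarrow> real \<Rightarrow> real"
  assumes "cont_ext \<Omega> I f"
  shows "t \<in> I \<Longrightarrow> continuous_on (closure \<Omega>) (up_to_bdry \<Omega> (\<lambda>x. f x t))"
    and "x \<in> \<Omega> \<Longrightarrow> continuous_on I (f x)"
proof -
  from assms obtain F where F: "continuous_on (closure \<Omega> \<times> I) (\<lambda>(x, t). F x t)"
    "\<And>x t. x \<in> \<Omega> \<Longrightarrow> t \<in> I \<Longrightarrow> F x t = f x t" by (auto simp: cont_ext_def)
  { assume t: "t \<in> I"
    have c: "continuous_on (closure \<Omega>) (\<lambda>x. F x t)" using continuous_on_slices(1)[OF F(1) t] .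
    have "up_to_bdry \<Omega> (\<lambda>x. f x t) x = F x t" if "x \<in> closure \<Omega>" for x
      using F(2) t that by (intro up_to_bdry_eq[OF c]) auto
    with c show "continuous_on (closure \<Omega>) (up_to_bdry \<Omega> (\<lambda>x. f x t))"
      by (simp cong: continuous_on_cong) }
  { assume x: "x \<in> \<Omega>"
    then have "continuous_on I (F x)" using continuous_on_slices(2)[OF F(1)] closure_subset by blast
    then show "continuous_on I (f x)" using F(2) x by (simp cong: continuous_on_cong) }
qed

text \<open>Continuity in \<open>x\<close> at frozen times serves integration over the domain and
  the passage to its boundary; the times of \<open>v\<close> and of the coefficients are separate,
  since the initial function is given at time 0 only. Continuity in \<open>t\<close> at an interior
  point serves the limit in the equation.\<close>

lemma second_order_op_continuous:
  assumes v: "C2_space \<Omega> I v"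
    and a2: "\<And>i j. continuous_on (closure \<Omega> \<times> J) (\<lambda>(x, t). a2 i j x t)"
    and a1: "\<And>i. continuous_on (closure \<Omega> \<times> J) (\<lambda>(x, t). a1 i x t)"
    and a0: "continuous_on (closure \<Omega> \<times> J) (\<lambda>(x, t). a0 x t)"
  shows "t \<in> I \<Longrightarrow> s \<in> J \<Longrightarrow>
      continuous_on (closure \<Omega>) (\<lambda>x. second_order_op \<Omega> a2 a1 a0 (\<lambda>y. v y t) x s)"
    and "x \<in> \<Omega> \<Longrightarrow> I \<subseteq> J \<Longrightarrow>
      continuous_on I (\<lambda>t. second_order_op \<Omega> a2 a1 a0 (\<lambda>y. v y t) x t)"
proof -
  have vc: "continuous_on (closure \<Omega> \<times> I) (\<lambda>(x, t). v x t)"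
    and v1: "\<And>i. cont_ext \<Omega> I (\<lambda>x t. partial_deriv i (\<lambda>y. v y t) x)"
    and v2: "\<And>i j. cont_ext \<Omega> I (\<lambda>x t. partial_deriv i (partial_deriv j (\<lambda>y. v y t)) x)"
    using v by (auto simp: C2_space_def)
  { assume "t \<in> I" "s \<in> J"
    then show "continuous_on (closure \<Omega>) (\<lambda>x. second_order_op \<Omega> a2 a1 a0 (\<lambda>y. v y t) x s)"
      unfolding second_order_op_def
      using cont_ext_continuous(1)[OF v1] cont_ext_continuous(1)[OF v2] continuous_on_slices(1)[OF a2]
        continuous_on_slices(1)[OF a1] continuous_on_slices(1)[OF a0] continuous_on_slices(1)[OF vc]
      by (intro continuous_on_add continuous_on_sum continuous_on_mult) auto }
  { assume x: "x \<in> \<Omega>" and IJ: "I \<subseteq> J"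
    then have xc: "x \<in> closure \<Omega>" using closure_subset by blast
    show "continuous_on I (\<lambda>t. second_order_op \<Omega> a2 a1 a0 (\<lambda>y. v y t) x t)"
      unfolding second_order_op_def up_to_bdry_def if_P[OF x]
      by (intro continuous_on_add continuous_on_sum continuous_on_mult
          cont_ext_continuous(2)[OF v1 x] cont_ext_continuous(2)[OF v2 x] continuous_on_slices(2)[OF vc xc]
          continuous_on_subset[OF continuous_on_slices(2)[OF a2 xc] IJ]
          continuous_on_subset[OF continuous_on_slices(2)[OF a1 xc] IJ]
          continuous_on_subset[OF continuous_on_slices(2)[OF a0 xc] IJ]) }
qed

lemma second_order_op_cong:
  assumes \<Omega>: "open \<Omega>" "x \<in> \<Omega>" and eq: "\<And>y. y \<in> \<Omega> \<Longrightarrow> v y = w y"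
  shows "second_order_op \<Omega> a2 a1 a0 v x t = second_order_op \<Omega> a2 a1 a0 w x t"
proof -
  have 1: "partial_deriv i v y = partial_deriv i w y" if "y \<in> \<Omega>" for i y
    by (rule partial_deriv_cong_open[OF \<Omega>(1) that eq])
  have "partial_deriv i (partial_deriv j v) x = partial_deriv i (partial_deriv j w) x" for i j
    by (rule partial_deriv_cong_open[OF \<Omega> 1])
  then show ?thesis using \<Omega> by (simp add: second_order_op_def up_to_bdry_def 1 eq)
qed

section \<open>Solutions near the initial time\<close>

lemma orders_admissible_less:
  assumes "orders_admissible \<alpha> M \<nu>" "0 < i" "i \<le> M"
  shows "\<nu> i < \<nu> 0"
  using assms(2,3)
proof (induction i)
  case (Suc i)
  have "\<nu> (Suc i) < \<nu> i" using assms(1) Suc.prems by (auto simp: orders_admissible_def)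
  also have "\<nu> i \<le> \<nu> 0" using Suc by (cases "i = 0") (auto intro: less_imp_le)
  finally show ?case .
qed simp

text \<open>The orders are parameters here, so that everything proved applies to each of the two
  order vectors compared in the uniqueness claim.\<close>

locale solved_problem =
  fixes P :: "('n::finite) problem" and T \<tau> :: real and \<nu> :: "nat \<Rightarrow> real"
    and u :: "real^'n \<Rightarrow> real \<Rightarrow> real"
  assumes domain: "open (Omega P)" "bounded (Omega P)" "Omega P \<noteq> {}"
    and times: "0 < \<tau>" "\<tau> < T"
    and r_adm: "r_admissible P T" and kernels: "kernels_admissible P T"
    and data: "data_regular P T" and solution: "classical_solution P \<tau> \<nu> u"
    and order_range: "\<And>i. i \<le> top_index P \<Longrightarrow> 0 < \<nu> i \<and> \<nu> i < 1"
    and order_less: "\<And>i. 0 < i \<Longrightarrow> i \<le> top_index P \<Longrightarrow> \<nu> i < \<nu> 0"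
begin

text \<open>This is what the equation leaves for the fractional operator at time 0, once the memory
  term has vanished; its observed value is \<open>C0_const P\<close>.\<close>

definition "initial_forcing x = source P x 0 - nonlin P (init_val P x) + L1 P (init_val P) x 0"

text \<open>For type II the coefficient sits under the derivative, which leaves the factor
  1.\<close>

definition "leading_coef x t = (case op_type P of TypeI \<Rightarrow> r_coef P 0 x t | TypeII \<Rightarrow> 1)"

lemma closure_Omega: "x \<in> Omega P \<Longrightarrow> x \<in> closure (Omega P)"
  using closure_subset by blast

lemma T_interval: "{0..\<tau>} \<subseteq> {0..T}" "0 \<in> {0..T}" "0 \<in> {0..\<tau>}"
  using times by auto

lemma solution_C2: "C2_space (Omega P) {0..\<tau>} u"
  using solution by (simp add: classical_solution_def)

lemma initial_C2: "C2_space (Omega P) {0} (\<lambda>x t. init_val P x)"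
  using data by (simp add: data_regular_def Let_def C2_closure_def)

lemma solution_initial: "x \<in> closure (Omega P) \<Longrightarrow> u x 0 = init_val P x"
  using solution by (simp add: classical_solution_def)

lemma solution_continuous:
  shows "t \<in> {0..\<tau>} \<Longrightarrow> continuous_on (closure (Omega P)) (\<lambda>x. u x t)"
    and "x \<in> closure (Omega P) \<Longrightarrow> continuous_on {0..\<tau>} (u x)"
  using continuous_on_slices[of "closure (Omega P)" "{0..\<tau>}" u] solution_C2 by (auto simp: C2_space_def)

lemma r_coef_continuous:
  assumes "i \<le> top_index P"
  shows "t \<in> {0..T} \<Longrightarrow> continuous_on (closure (Omega P)) (\<lambda>x. r_coef P i x t)"
    and "x \<in> closure (Omega P) \<Longrightarrow> continuous_on {0..T} (r_coef P i x)"
  using continuous_on_slices[of "closure (Omega P)" "{0..T}" "r_coef P i"] r_adm assms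
  by (auto simp: r_admissible_def)

lemma dt_arg_continuous:
  assumes "i \<le> top_index P"
  shows "t \<in> {0..\<tau>} \<Longrightarrow> continuous_on (closure (Omega P)) (\<lambda>x. dt_arg P i u x t)"
    and "x \<in> closure (Omega P) \<Longrightarrow> continuous_on {0..\<tau>} (dt_arg P i u x)"
proof -
  show "continuous_on (closure (Omega P)) (\<lambda>x. dt_arg P i u x t)" if "t \<in> {0..\<tau>}"
    using that solution_continuous r_coef_continuous[OF assms] T_interval
    by (cases "op_type P") (auto simp: dt_arg_def intro!: continuous_on_mult)
  assume x: "x \<in> closure (Omega P)"
  have r: "continuous_on {0..\<tau>} (\<lambda>t. r_coef P i x t)"
    by (rule continuous_on_subset[OF r_coef_continuous(2)[OF assms x] T_interval(1)])
  have "continuous_on {0..\<tau>} (\<lambda>t. dt_arg P i u x t)"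
    using solution_continuous(2)[OF x] continuous_on_mult[OF r solution_continuous(2)[OF x]]
    by (cases "op_type P") (simp_all add: dt_arg_def)
  then show "continuous_on {0..\<tau>} (dt_arg P i u x)" .
qed

lemma initial_data_continuous:
  shows "continuous_on (closure (Omega P)) (\<lambda>x. source P x 0)"
    and "continuous_on (closure (Omega P)) (\<lambda>x. nonlin P (init_val P x))"
    and "continuous_on (closure (Omega P)) (\<lambda>x. L1 P (init_val P) x 0)"
proof -
  show "continuous_on (closure (Omega P)) (\<lambda>x. source P x 0)"
    using continuous_on_slices(1)[of _ "{0..T}" "source P"] data T_interval
    by (auto simp: data_regular_def Let_def)
  have "continuous_on (closure (Omega P)) (init_val P)"
    using continuous_on_slices(1)[of _ "{0}" "\<lambda>x t. init_val P x"] initial_C2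
    by (auto simp: C2_space_def)
  then show "continuous_on (closure (Omega P)) (\<lambda>x. nonlin P (init_val P x))"
    using data by (auto simp: data_regular_def Let_def intro: continuous_on_compose2[of UNIV])
  show "continuous_on (closure (Omega P)) (\<lambda>x. L1 P (init_val P) x 0)"
    unfolding L1_def using data T_interval
    by (intro second_order_op_continuous(1)[OF initial_C2, of "{0..T}"]) (auto simp: data_regular_def Let_def)
qed

lemma initial_forcing_continuous: "continuous_on (closure (Omega P)) initial_forcing"
  unfolding initial_forcing_def[abs_def]
  by (intro continuous_on_add continuous_on_diff initial_data_continuous)

text \<open>The increment quotient of order \<open>\<nu> i\<close> has two limits:
  \<open>w 0 / Gamma (1 + \<nu> i)\<close> by \<open>caputo_limit\<close>, and 0 because the leading
  derivative makes increments of the larger order \<open>\<nu> 0\<close>.\<close>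

lemma lower_order_derivative_vanishes:
  assumes x: "x \<in> closure (Omega P)" and i: "0 < i" "i \<le> top_index P"
    and w0: "caputo_on \<tau> (\<nu> 0) (dt_arg P 0 u x) w0"
    and w: "caputo_on \<tau> (\<nu> i) (dt_arg P i u x) w"
  shows "w 0 = 0"
proof -
  have ord: "0 < \<nu> 0" "\<nu> 0 < 1" "0 < \<nu> i" "\<nu> i < 1" "\<nu> i < \<nu> 0"
    using order_range[of 0] order_range[of i] order_less i by auto
  have lead: "((\<lambda>t. (dt_arg P 0 u x t - dt_arg P 0 u x 0) / t powr \<nu> i) \<longlongrightarrow> 0) (at_right 0)"
    by (rule increment_limit_smaller_power[OF caputo_limit[OF dt_arg_continuous(2)]])
      (use x ord w0 times in auto)
  have "((\<lambda>t. (dt_arg P i u x t - dt_arg P i u x 0) / t powr \<nu> i) \<longlongrightarrow> 0) (at_right 0)"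
  proof (cases "op_type P")
    case TypeI
    then show ?thesis using lead by (simp add: dt_arg_def)
  next
    case TypeII
    have r: "(r_coef P j x \<longlongrightarrow> r_coef P j x 0) (at_right 0)"
      and dr: "((\<lambda>t. (r_coef P j x t - r_coef P j x 0) / t powr \<nu> i) \<longlongrightarrow> 0) (at_right 0)"
      if j: "j \<le> top_index P" for j
    proof -
      show "(r_coef P j x \<longlongrightarrow> r_coef P j x 0) (at_right 0)"
        by (rule continuous_on_Icc_at_rightD[OF r_coef_continuous(2)[OF j x]]) (use times in auto)
      from r_adm j TypeII obtain r' where
        "\<forall>x\<in>closure (Omega P). \<forall>t\<in>{0..T}. (r_coef P j x has_real_derivative r' x t) (at t within {0..T})"
        unfolding r_admissible_def by blast
      then have "(r_coef P j x has_real_derivative r' x 0) (at 0 within {0..T})"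
        using x T_interval by blast
      then show "((\<lambda>t. (r_coef P j x t - r_coef P j x 0) / t powr \<nu> i) \<longlongrightarrow> 0) (at_right 0)"
        by (rule derivative_increment_limit) (use times ord in auto)
    qed
    \<comment> \<open>The positive lower bound on the leading coefficient allows the division in
      \<open>weighted_increment_limit\<close>.\<close>
    obtain d where d: "0 < d" "\<forall>x\<in>closure (Omega P). \<forall>t\<in>{0..T}. d \<le> r_coef P 0 x t"
      using r_adm unfolding r_admissible_def by blast
    have "d \<le> r_coef P 0 x 0" using d(2) x T_interval(2) by blast
    then have "r_coef P 0 x 0 \<noteq> 0" using d(1) by linarith
    moreover have "((\<lambda>t. (r_coef P 0 x t * u x t - r_coef P 0 x 0 * u x 0) / t powr \<nu> i) \<longlongrightarrow> 0) (at_right 0)"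
      using lead TypeII by (simp add: dt_arg_def)
    ultimately have "((\<lambda>t. (r_coef P i x t * u x t - r_coef P i x 0 * u x 0) / t powr \<nu> i) \<longlongrightarrow> 0) (at_right 0)"
      using weighted_increment_limit[OF _ dr[of 0] r[of 0] _ dr[OF i(2)] r[OF i(2)]] by simp
    then show ?thesis using TypeII by (simp add: dt_arg_def)
  qed
  moreover have "((\<lambda>t. (dt_arg P i u x t - dt_arg P i u x 0) / t powr \<nu> i) \<longlongrightarrow> w 0 / Gamma (1 + \<nu> i)) (at_right 0)"
    by (rule caputo_limit[OF dt_arg_continuous(2)]) (use x i ord w times in auto)
  ultimately have "w 0 / Gamma (1 + \<nu> i) = 0"
    using tendsto_unique[OF trivial_limit_at_right_real] by blast
  moreover have "Gamma (1 + \<nu> i) > 0" using ord by (intro Gamma_real_pos) auto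
  ultimately show ?thesis by simp
qed

text \<open>Letting \<open>t\<close> tend to 0 in the equation at an interior point removes the
  memory term and all lower orders. The resulting identity extends to the closure by continuity,
  which covers an observation point on the boundary.\<close>

lemma leading_derivative:
  obtains W where "continuous_on (closure (Omega P) \<times> {0..\<tau>}) (\<lambda>(x, t). W x t)"
    "\<And>x. x \<in> closure (Omega P) \<Longrightarrow> caputo_on \<tau> (\<nu> 0) (dt_arg P 0 u x) (W x)"
    "\<And>x. x \<in> closure (Omega P) \<Longrightarrow> leading_coef x 0 * W x 0 = initial_forcing x"
proof -
  have "\<forall>i\<in>{..top_index P}. \<exists>W. continuous_on (closure (Omega P) \<times> {0..\<tau>}) (\<lambda>(x, t). W x t) \<and>
      (\<forall>x\<in>closure (Omega P). caputo_on \<tau> (\<nu> i) (dt_arg P i u x) (W x))"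
    using solution by (auto simp: classical_solution_def)
  from bchoice[OF this] obtain W where "\<forall>i\<in>{..top_index P}.
      continuous_on (closure (Omega P) \<times> {0..\<tau>}) (\<lambda>(x, t). W i x t) \<and>
      (\<forall>x\<in>closure (Omega P). caputo_on \<tau> (\<nu> i) (dt_arg P i u x) (W i x))"
    by (elim exE)
  then have W: "continuous_on (closure (Omega P) \<times> {0..\<tau>}) (\<lambda>(x, t). W i x t)"
    and cap: "x \<in> closure (Omega P) \<Longrightarrow> caputo_on \<tau> (\<nu> i) (dt_arg P i u x) (W i x)"
    if "i \<le> top_index P" for i x using that by auto
  have interior: "leading_coef x 0 * W 0 x 0 = initial_forcing x" if x: "x \<in> Omega P" for x
  proof -
    note xc = closure_Omega[OF x]
    \<comment> \<open>With these factors both operator types take the form of one sum of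
      \<open>\<rho> i t * W i x t\<close>.\<close>
    define \<rho> where "\<rho> = (\<lambda>i t. case op_type P of TypeI \<Rightarrow> r_coef P i x t | TypeII \<Rightarrow> 1)"
    have \<rho>: "(\<rho> i \<longlongrightarrow> \<rho> i 0) (at_right 0)" if "i \<le> top_index P" for i
      using continuous_on_Icc_at_rightD[OF r_coef_continuous(2)[OF that xc]] times
      by (cases "op_type P") (auto simp: \<rho>_def)
    have Wlim: "(W i x \<longlongrightarrow> W i x 0) (at_right 0)" if "i \<le> top_index P" for i
      using cap[OF that xc] times by (intro continuous_on_Icc_at_rightD[of 0 \<tau>]) (auto simp: caputo_on_def)
    have coefs: "continuous_on (closure (Omega P) \<times> {0..T}) (\<lambda>(x, t). coef_a2 P i j x t)"
      "continuous_on (closure (Omega P) \<times> {0..T}) (\<lambda>(x, t). coef_b2 P i j x t)"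
      "continuous_on (closure (Omega P) \<times> {0..T}) (\<lambda>(x, t). coef_a1 P i x t)"
      "continuous_on (closure (Omega P) \<times> {0..T}) (\<lambda>(x, t). coef_b1 P i x t)"
      "continuous_on (closure (Omega P) \<times> {0..T}) (\<lambda>(x, t). coef_a0 P x t)"
      "continuous_on (closure (Omega P) \<times> {0..T}) (\<lambda>(x, t). coef_b0 P x t)"
      "continuous_on (closure (Omega P) \<times> {0..T}) (\<lambda>(x, t). source P x t)" for i j
      using data by (auto simp: data_regular_def Let_def)
    have "continuous_on {0..\<tau>} (\<lambda>t. L1 P (\<lambda>y. u y t) x t)"
      unfolding L1_def
      by (rule second_order_op_continuous(2)[OF solution_C2 coefs(1,3,5) x T_interval(1)])
    from continuous_on_Icc_at_rightD[OF this times(1)]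
    have L1: "((\<lambda>t. L1 P (\<lambda>y. u y t) x t) \<longlongrightarrow> L1 P (\<lambda>y. u y 0) x 0) (at_right 0)" .
    have L1_init: "L1 P (\<lambda>y. u y 0) x 0 = L1 P (init_val P) x 0"
      unfolding L1_def by (intro second_order_op_cong domain x) (simp add: solution_initial closure_Omega)
    have "continuous_on {0..\<tau>} (\<lambda>t. L2 P (\<lambda>y. u y t) x t)"
      unfolding L2_def
      by (rule second_order_op_continuous(2)[OF solution_C2 coefs(2,4,6) x T_interval(1)])
    then have mem: "(tconv (mem_kernel P) (\<lambda>s. L2 P (\<lambda>y. u y s) x s) \<longlongrightarrow> 0) (at_right 0)"
      using kernels times by (intro tconv_tendsto_0[where T = T]) (auto simp: kernels_admissible_def)
    have "continuous_on {0..\<tau>} (\<lambda>t. nonlin P (u x t))"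
      using data solution_continuous(2)[OF xc]
      by (auto simp: data_regular_def Let_def intro: continuous_on_compose2[of UNIV])
    from continuous_on_Icc_at_rightD[OF this times(1)]
    have nonlin: "((\<lambda>t. nonlin P (u x t)) \<longlongrightarrow> nonlin P (u x 0)) (at_right 0)" .
    have source: "(source P x \<longlongrightarrow> source P x 0) (at_right 0)"
      using continuous_on_slices(2)[OF coefs(7) xc] times by (intro continuous_on_Icc_at_rightD[of 0 T]) auto
    have "((\<lambda>t. (\<Sum>i\<le>top_index P. \<rho> i t * W i x t) - L1 P (\<lambda>y. u y t) x t
          - tconv (mem_kernel P) (\<lambda>s. L2 P (\<lambda>y. u y s) x s) t + nonlin P (u x t) - source P x t)
        \<longlongrightarrow> (\<Sum>i\<le>top_index P. \<rho> i 0 * W i x 0) - L1 P (\<lambda>y. u y 0) x 0 - 0 + nonlin P (u x 0) - source P x 0)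
        (at_right 0)"
      by (intro tendsto_diff tendsto_add tendsto_sum tendsto_mult L1 mem nonlin source \<rho> Wlim) auto
    moreover have "eventually (\<lambda>t. t \<in> {0<..<\<tau>}) (at_right 0)"
      using times by (intro eventually_at_right_real)
    then have "eventually (\<lambda>t. (\<Sum>i\<le>top_index P. \<rho> i t * W i x t) - L1 P (\<lambda>y. u y t) x t
          - tconv (mem_kernel P) (\<lambda>s. L2 P (\<lambda>y. u y s) x s) t + nonlin P (u x t) - source P x t = 0) (at_right 0)"
    proof eventually_elim
      case (elim t)
      have "caputo (\<nu> i) (dt_arg P i u x) t = W i x t" if "i \<le> top_index P" for i
        using cap[OF that xc] elim by (auto simp: caputo_on_def)
      then have "Dt P \<nu> u x t = (\<Sum>i\<le>top_index P. \<rho> i t * W i x t)"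
        by (cases "op_type P") (simp_all add: Dt_def \<rho>_def)
      moreover have "Dt P \<nu> u x t - L1 P (\<lambda>y. u y t) x t
          - tconv (mem_kernel P) (\<lambda>s. L2 P (\<lambda>y. u y s) x s) t + nonlin P (u x t) = source P x t"
        using solution x elim by (simp add: classical_solution_def)
      ultimately show ?case by simp
    qed
    ultimately have "(\<Sum>i\<le>top_index P. \<rho> i 0 * W i x 0) - L1 P (\<lambda>y. u y 0) x 0 - 0
        + nonlin P (u x 0) - source P x 0 = 0"
      by (intro tendsto_unique[OF trivial_limit_at_right_real _ tendsto_eventually])
    moreover have "(\<Sum>i\<le>top_index P. \<rho> i 0 * W i x 0) = (\<Sum>i\<in>{0}. \<rho> i 0 * W i x 0)"
      using lower_order_derivative_vanishes[OF xc _ _ cap[OF _ xc] cap[OF _ xc]]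
      by (intro sum.mono_neutral_right) auto
    moreover have "\<rho> 0 0 = leading_coef x 0" by (simp add: \<rho>_def leading_coef_def)
    ultimately show ?thesis
      by (simp add: initial_forcing_def L1_init solution_initial[OF xc])
  qed
  have "leading_coef x 0 * W 0 x 0 - initial_forcing x = 0" if "x \<in> closure (Omega P)" for x
  proof (rule continuous_constant_on_closure[OF _ _ that])
    have "continuous_on (closure (Omega P)) (\<lambda>x. leading_coef x 0)"
      using r_coef_continuous(1)[of 0 0] T_interval by (cases "op_type P") (auto simp: leading_coef_def)
    then show "continuous_on (closure (Omega P)) (\<lambda>x. leading_coef x 0 * W 0 x 0 - initial_forcing x)"
      using continuous_on_slices(1)[OF W[of 0] T_interval(3)] initial_forcing_continuous
      by (intro continuous_on_diff continuous_on_mult) auto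
  qed (use interior in simp)
  with W[of 0] cap[of 0] that show thesis by simp
qed

section \<open>From the observation to the order\<close>

text \<open>The pointwise expansion is evaluated at the observation point, or its uniform version is
  integrated over the domain. Multiplied by \<open>Gamma (1 + \<nu> 0)\<close> and the leading
  coefficient, the limit becomes \<open>C0_const P\<close>, hence it is nonzero.\<close>

lemma observed_increment_asymptotics:
  assumes obs: "obs_point_admissible P" and C0: "C0_const P \<noteq> 0"
  obtains A where "A \<noteq> 0"
    "((\<lambda>t. (observed P (\<lambda>x. dt_arg P 0 u x t) - observed P (\<lambda>x. dt_arg P 0 u x 0)) / t powr \<nu> 0)
      \<longlongrightarrow> A) (at_right 0)"
proof -
  have ord: "0 < \<nu> 0" "\<nu> 0 < 1" using order_range[of 0] by auto
  have G: "Gamma (1 + \<nu> 0) > 0" using ord by (intro Gamma_real_pos) auto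
  obtain W where W: "continuous_on (closure (Omega P) \<times> {0..\<tau>}) (\<lambda>(x, t). W x t)"
    and cap: "\<And>x. x \<in> closure (Omega P) \<Longrightarrow> caputo_on \<tau> (\<nu> 0) (dt_arg P 0 u x) (W x)"
    and lead: "\<And>x. x \<in> closure (Omega P) \<Longrightarrow> leading_coef x 0 * W x 0 = initial_forcing x"
    using leading_derivative by blast
  show thesis
  proof (cases "obs P")
    case (LO x0 r)
    then have x0: "x0 \<in> closure (Omega P)" using obs by (simp add: obs_point_admissible_def)
    have "initial_forcing x0 = C0_const P" using LO by (simp add: initial_forcing_def C0_const_def)
    then have "W x0 0 \<noteq> 0" using lead[OF x0] C0 by auto
    then have "W x0 0 / Gamma (1 + \<nu> 0) \<noteq> 0" using G by simp
    moreover have "((\<lambda>t. (dt_arg P 0 u x0 t - dt_arg P 0 u x0 0) / t powr \<nu> 0)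
        \<longlongrightarrow> W x0 0 / Gamma (1 + \<nu> 0)) (at_right 0)"
      by (rule caputo_limit[OF dt_arg_continuous(2)[OF _ x0] ord cap[OF x0] times(1)]) simp
    ultimately show thesis
      by (intro that[of "W x0 0 / Gamma (1 + \<nu> 0)"]) (simp_all add: observed_def LO)
  next
    case (NLO r)
    have int: "f integrable_on Omega P" if "continuous_on (closure (Omega P)) f" for f :: "real^'n \<Rightarrow> real"
      using that domain by (intro integrable_on_open_bounded) auto
    have W0: "continuous_on (closure (Omega P)) (\<lambda>x. W x 0)"
      by (rule continuous_on_slices(1)[OF W T_interval(3)])
    \<comment> \<open>For the integral observation the coefficients do not depend on
      \<open>x\<close>, so the leading one comes out of the integral.\<close>
    obtain c where c: "\<And>x. leading_coef x 0 = c"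
      using NLO by (cases "op_type P") (simp_all add: leading_coef_def r_coef_def)
    have "c * integral (Omega P) (\<lambda>x. W x 0) = integral (Omega P) (\<lambda>x. leading_coef x 0 * W x 0)"
      by (simp add: c)
    also have "\<dots> = integral (Omega P) initial_forcing"
      by (intro integral_cong lead closure_Omega)
    also have "\<dots> = C0_const P"
      using NLO int[OF initial_data_continuous(1)] int[OF initial_data_continuous(2)]
        int[OF initial_data_continuous(3)]
      by (simp add: initial_forcing_def[abs_def] C0_const_def integral_add integral_diff integrable_diff)
    finally have "integral (Omega P) (\<lambda>x. W x 0) \<noteq> 0" using C0 by auto
    then have nz: "integral (Omega P) (\<lambda>x. W x 0 / Gamma (1 + \<nu> 0)) \<noteq> 0" using G by simp
    have dt_int: "(\<lambda>x. dt_arg P 0 u x t) integrable_on Omega P" if "t \<in> {0..\<tau>}" for t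
      using dt_arg_continuous(1)[OF _ that] by (intro int) simp
    have "uniform_limit (closure (Omega P)) (\<lambda>t x. (dt_arg P 0 u x t - dt_arg P 0 u x 0) / t powr \<nu> 0)
        (\<lambda>x. W x 0 / Gamma (1 + \<nu> 0)) (at_right 0)"
      using domain by (intro caputo_uniform_limit[OF dt_arg_continuous(2) ord cap _ W times(1)])
        (auto simp: compact_closure)
    then have unif: "uniform_limit (Omega P) (\<lambda>t x. (dt_arg P 0 u x t - dt_arg P 0 u x 0) / t powr \<nu> 0)
        (\<lambda>x. W x 0 / Gamma (1 + \<nu> 0)) (at_right 0)"
      by (rule uniform_limit_on_subset) (rule closure_subset)
    have ev: "eventually (\<lambda>t. t \<in> {0<..<\<tau>}) (at_right 0)"
      using times by (intro eventually_at_right_real)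
    have lim: "((\<lambda>t. integral (Omega P) (\<lambda>x. (dt_arg P 0 u x t - dt_arg P 0 u x 0) / t powr \<nu> 0))
        \<longlongrightarrow> integral (Omega P) (\<lambda>x. W x 0 / Gamma (1 + \<nu> 0))) (at_right 0)"
    proof (rule uniform_limit_integral_on[OF unif])
      show "Omega P \<in> lmeasurable" using domain by (intro lmeasurable_open)
      show "eventually (\<lambda>t. (\<lambda>x. (dt_arg P 0 u x t - dt_arg P 0 u x 0) / t powr \<nu> 0) integrable_on Omega P)
          (at_right 0)"
        using ev by eventually_elim (use T_interval in \<open>auto intro!: integrable_on_divide integrable_diff dt_int\<close>)
      show "(\<lambda>x. W x 0 / Gamma (1 + \<nu> 0)) integrable_on Omega P"
        using W0 by (intro integrable_on_divide int)
    qed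
    have "eventually (\<lambda>t. integral (Omega P) (\<lambda>x. (dt_arg P 0 u x t - dt_arg P 0 u x 0) / t powr \<nu> 0) =
        (observed P (\<lambda>x. dt_arg P 0 u x t) - observed P (\<lambda>x. dt_arg P 0 u x 0)) / t powr \<nu> 0) (at_right 0)"
      using ev
    proof eventually_elim
      case (elim t)
      then show ?case using NLO dt_int[of t] dt_int[OF T_interval(3)]
        by (simp add: observed_def integral_diff)
    qed
    from that[OF nz Lim_transform_eventually[OF lim this]] show thesis .
  qed
qed

text \<open>The weight passes through the observation: it is evaluated at the same point for
  \<open>LO\<close>, and it is constant in \<open>x\<close> for \<open>NLO\<close>.\<close>

lemma observed_dt_arg:
  "observed P (\<lambda>x. dt_arg P 0 u x t) =
    (case op_type P of TypeI \<Rightarrow> observed P (\<lambda>x. u x t) | TypeII \<Rightarrow> obs_weight P t * observed P (\<lambda>x. u x t))"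
  by (cases "op_type P"; cases "obs P") (simp_all add: observed_def dt_arg_def obs_weight_def r_coef_def)

lemma obs_weight_continuous:
  assumes "obs_point_admissible P"
  shows "continuous_on {0..\<tau>} (obs_weight P)"
proof -
  obtain x where x: "x \<in> closure (Omega P)" "obs_weight P = r_coef P 0 x"
  proof (cases "obs P")
    case (LO x0 r)
    then show ?thesis using assms that[of x0]
      by (auto simp: obs_point_admissible_def obs_weight_def r_coef_def fun_eq_iff)
  next
    \<comment> \<open>The coefficient is independent of \<open>x\<close>, so any point of the
      nonempty domain serves.\<close>
    case (NLO r)
    then show ?thesis using domain(3) that closure_Omega
      by (auto simp: obs_weight_def r_coef_def fun_eq_iff)
  qed
  show ?thesis unfolding x(2)
    by (rule continuous_on_subset[OF r_coef_continuous(2)[OF _ x(1)] T_interval(1)]) simp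
qed

lemma order_formula:
  assumes obs: "obs_point_admissible P" and C0: "C0_const P \<noteq> 0"
    and \<psi>: "continuous_on {0..\<tau>} \<psi>" "\<And>t. t \<in> {0..\<tau>} \<Longrightarrow> observed P (\<lambda>x. u x t) = \<psi> t"
  defines "v \<equiv> (\<lambda>t. case op_type P of TypeI \<Rightarrow> \<psi> t | TypeII \<Rightarrow> obs_weight P t * \<psi> t)"
  shows "((\<lambda>t. t * (v t - v 0) / integral {0..t} (\<lambda>s. v s - v 0) - 1) \<longlongrightarrow> \<nu> 0) (at_right 0)"
proof -
  have v_eq: "observed P (\<lambda>x. dt_arg P 0 u x t) = v t" if "t \<in> {0..\<tau>}" for t
    unfolding observed_dt_arg v_def \<psi>(2)[OF that] ..
  obtain A where A: "A \<noteq> 0"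
    "((\<lambda>t. (observed P (\<lambda>x. dt_arg P 0 u x t) - observed P (\<lambda>x. dt_arg P 0 u x 0)) / t powr \<nu> 0)
      \<longlongrightarrow> A) (at_right 0)"
    using observed_increment_asymptotics[OF obs C0] by blast
  have "eventually (\<lambda>t. t \<in> {0<..<\<tau>}) (at_right 0)"
    using times by (intro eventually_at_right_real)
  then have "eventually (\<lambda>t. (observed P (\<lambda>x. dt_arg P 0 u x t) - observed P (\<lambda>x. dt_arg P 0 u x 0)) / t powr \<nu> 0 =
      (v t - v 0) / t powr \<nu> 0) (at_right 0)"
    by eventually_elim (use T_interval in \<open>auto simp: v_eq\<close>)
  from Lim_transform_eventually[OF A(2) this]
  have lim: "((\<lambda>t. (v t - v 0) / t powr \<nu> 0) \<longlongrightarrow> A) (at_right 0)" .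
  have "continuous_on {0..\<tau>} v"
    unfolding v_def using \<psi>(1) obs_weight_continuous[OF obs]
    by (cases "op_type P") (auto intro: continuous_on_mult)
  then have "continuous_on {0..\<tau>} (\<lambda>t. v t - v 0)" by (intro continuous_intros)
  from powr_asymptotics_ratio[OF this times(1) _ lim A(1)] order_range[of 0] show ?thesis by simp
qed

lemma observed_initial:
  assumes "obs_point_admissible P"
  shows "observed P (\<lambda>x. u x 0) = observed P (init_val P)"
proof (cases "obs P")
  case (LO x0 r)
  then show ?thesis using assms by (simp add: observed_def obs_point_admissible_def solution_initial)
next
  case (NLO r)
  have "integral (Omega P) (\<lambda>x. u x 0) = integral (Omega P) (init_val P)"
    by (intro integral_cong solution_initial closure_Omega)
  then show ?thesis using NLO by (simp add: observed_def)
qed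

end

theorem theorem4p1:
  fixes P :: "('n::finite) problem"
    and \<alpha> T tstar :: real
    and sol :: "(nat \<Rightarrow> real) \<Rightarrow> (real^'n \<Rightarrow> real \<Rightarrow> real) \<Rightarrow> bool"
    and \<psi> :: "real \<Rightarrow> real" and \<nu> :: "nat \<Rightarrow> real" and u :: "real^'n \<Rightarrow> real \<Rightarrow> real"
  assumes "0 < \<alpha>" "\<alpha> < 1" and "0 < T" and "0 < tstar" "tstar < min 1 T"
    and "bounded_C2_domain \<alpha> (Omega P)"
    and "operators_admissible P \<alpha> T"
    and "r_admissible P T"
    and "kernels_admissible P T"
    and "data_regular P T"
    and "obs_point_admissible P"
    and "C0_const P \<noteq> 0"
    and "order_observation P \<alpha> T tstar sol \<psi> \<nu> u"
  shows "\<psi> 0 = observed P (init_val P) \<and>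
    (op_type P = TypeI \<longrightarrow>
      ((\<lambda>t. t * (\<psi> t - \<psi> 0) / integral {0..t} (\<lambda>s. \<psi> s - \<psi> 0) - 1) \<longlongrightarrow> \<nu> 0) (at_right 0)) \<and>
    (op_type P = TypeII \<longrightarrow>
      ((\<lambda>t. t * (obs_weight P t * \<psi> t - obs_weight P 0 * \<psi> 0) /
          integral {0..t} (\<lambda>s. obs_weight P s * \<psi> s - obs_weight P 0 * \<psi> 0) - 1)
        \<longlongrightarrow> \<nu> 0) (at_right 0)) \<and>
    (\<forall>\<nu>' u'. order_observation P \<alpha> T tstar sol \<psi> \<nu>' u' \<longrightarrow> \<nu>' 0 = \<nu> 0)"
proof -
  \<comment> \<open>This function is built from the observation and the weight alone. The same
    quotient therefore converges to the leading order of every admissible order vector, and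
    uniqueness of limits identifies these orders.\<close>
  define v where "v = (\<lambda>t. case op_type P of TypeI \<Rightarrow> \<psi> t | TypeII \<Rightarrow> obs_weight P t * \<psi> t)"
  have solved: "solved_problem P T tstar \<nu>' u'"
    if "order_observation P \<alpha> T tstar sol \<psi> \<nu>' u'" for \<nu>' u'
    using that assms orders_admissible_less[of \<alpha> "top_index P" \<nu>']
    by unfold_locales (auto simp: order_observation_def bounded_C2_domain_def orders_admissible_def)
  have lim: "((\<lambda>t. t * (v t - v 0) / integral {0..t} (\<lambda>s. v s - v 0) - 1) \<longlongrightarrow> \<nu>' 0) (at_right 0)"
    if "order_observation P \<alpha> T tstar sol \<psi> \<nu>' u'" for \<nu>' u'
    unfolding v_def using that assms(11,12)
    by (intro solved_problem.order_formula[OF solved[OF that]])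
      (auto simp: order_observation_def observed_regular_def)
  have "\<psi> 0 = observed P (init_val P)"
    using solved_problem.observed_initial[OF solved[OF assms(13)] assms(11)] assms(4,13)
    by (auto simp: order_observation_def)
  moreover have "\<nu>' 0 = \<nu> 0" if "order_observation P \<alpha> T tstar sol \<psi> \<nu>' u'" for \<nu>' u'
    using tendsto_unique[OF trivial_limit_at_right_real lim[OF that] lim[OF assms(13)]] .
  ultimately show ?thesis
    using lim[OF assms(13)] by (auto simp: v_def)
qed

end
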